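(* Let $(\Omega,\mathcal F,\mathbb P)$ be a nonatomic probability space and $\mathcal X_c$ the set of random variables on it with compactly supported distribution. A law-based functional $\rho:\mathcal X_c\to\mathbb R$ is monotone, comonotonic-additive, p-quasi-convex and p-locally indifferent with $\rho(1)=1$ if and only if $\rho=kQ_\alpha^c+(1-k)Q_0$ for some $c\in[0,1]$ and $\alpha,k\in(0,1]$.
   Context: A distribution is a Borel probability measure on $\mathbb R$; write $F(x)=F((-\infty,x])$. $\mathcal M_c$ is the set of compactly supported distributions. A functional $\rho$ on $\mathcal X_c$ is law-based if $\rho(X)=\rho(Y)$ whenever $X,Y$ have the same distribution; it is then also viewed as a functional on $\mathcal M_c$ via $\rho(F)=\rho(X)$ for $X$ with distribution $F$. Monotone: $\rho(F)\le\rho(G)$ for all $F,G\in\mathcal M_c$ with $\int f\,dF\le\int f\,dG$ for all increasing $f:\mathbb R\to\mathbb R$ (first-order stochastic dominance). $X,Y$ are comonotonic if there is $\Omega_0\in\mathcal F$ with $\mathbb P(\Omega_0)=1$ and $(X(\omega)-X(\omega'))(Y(\omega)-Y(\omega'))\ge0$ for all $\omega,\omega'\in\Omega_0$. Comonotonic-additive: $\rho(X+Y)=\rho(X)+\rho(Y)$ for all comonotonic $X,Y\in\mathcal X_c$. p-quasi-convex: $\rho(\lambda F+(1-\lambda)G)\le\max\{\rho(F),\rho(G)\}$ for all $F,G\in\mathcal M_c$, $\lambda\in[0,1]$. p-locally indifferent: there exist $A,B\in\mathcal F$ with $\mathbb P(A)\ne\mathbb P(B)$ and $\rho(\mathbf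 1_A)=\rho(\mathbf 1_B)>\rho(0)$. Quantiles: for $\alpha\in(0,1)$, $Q_\alpha^-(F)=\inf\{x:F(x)\ge\alpha\}$, $Q_\alpha^+(F)=\inf\{x:F(x)>\alpha\}$; $Q_0^\pm(F)=Q_0(F)=\inf\{x:F(x)>0\}$; $Q_1^\pm(F)=Q_1(F)=\inf\{x:F(x)\ge1\}$. For $c,\alpha\in[0,1]$, $Q_\alpha^c=cQ_\alpha^++(1-c)Q_\alpha^-$. For a random variable $X$, these are applied to its distribution. *)

theory Defs
  imports "HOL-Probability.Probability"
begin

definition nonatomic :: "'a measure \<Rightarrow> bool" where
  "nonatomic M \<longleftrightarrow> (\<forall>A\<in>sets M. measure M A > 0 \<longrightarrow>
     (\<exists>B\<in>sets M. B \<subseteq> A \<and> 0 < measure M B \<and> measure M B < measure M A))"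

definition cs_distributions :: "real measure set" where
  "cs_distributions = {F. real_distribution F \<and> (\<exists>K. compact K \<and> measure F K = 1)}"

definition cs_rvs :: "'a measure \<Rightarrow> ('a \<Rightarrow> real) set" where
  "cs_rvs M = {X \<in> borel_measurable M. distr M borel X \<in> cs_distributions}"

definition law_based :: "'a measure \<Rightarrow> (('a \<Rightarrow> real) \<Rightarrow> real) \<Rightarrow> bool" where
  "law_based M \<rho> \<longleftrightarrow>
     (\<forall>X\<in>cs_rvs M. \<forall>Y\<in>cs_rvs M. distr M borel X = distr M borel Y \<longrightarrow> \<rho> X = \<rho> Y)"

text \<open>A law-based functional seen as a functional on distributions. The value does not depend
  on the chosen representative; on a nonatomic probability space every compactly supported
  distribution has one.\<close>

definition on_laws :: "'a measure \<Rightarrow> (('a \<Rightarrow> real) \<Rightarrow> real) \<Rightarrow> real measure \<Rightarrow> real" where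
  "on_laws M \<rho> F = \<rho> (SOME X. X \<in> cs_rvs M \<and> distr M borel X = F)"

lemma on_laws_distr:
  assumes "law_based M \<rho>" and "X \<in> cs_rvs M"
  shows "on_laws M \<rho> (distr M borel X) = \<rho> X"
proof -
  let ?P = "\<lambda>Y. Y \<in> cs_rvs M \<and> distr M borel Y = distr M borel X"
  have "?P (SOME Y. ?P Y)"
    by (rule someI[of ?P X]) (use assms in simp)
  then show ?thesis
    using assms unfolding on_laws_def law_based_def by blast
qed

text \<open>Increasing functions are bounded on compact sets, so both Bochner integrals below are
  integrals of integrable functions.\<close>

definition fosd_monotone :: "'a measure \<Rightarrow> (('a \<Rightarrow> real) \<Rightarrow> real) \<Rightarrow> bool" where
  "fosd_monotone M \<rho> \<longleftrightarrow> (\<forall>F\<in>cs_distributions. \<forall>G\<in>cs_distributions.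
     (\<forall>f :: real \<Rightarrow> real. mono f \<longrightarrow> (\<integral>x. f x \<partial>F) \<le> (\<integral>x. f x \<partial>G)) \<longrightarrow>
     on_laws M \<rho> F \<le> on_laws M \<rho> G)"

definition comonotonic :: "'a measure \<Rightarrow> ('a \<Rightarrow> real) \<Rightarrow> ('a \<Rightarrow> real) \<Rightarrow> bool" where
  "comonotonic M X Y \<longleftrightarrow> (\<exists>S\<in>sets M. measure M S = 1 \<and>
     (\<forall>w\<in>S. \<forall>w'\<in>S. (X w - X w') * (Y w - Y w') \<ge> 0))"

definition comonotonic_additive :: "'a measure \<Rightarrow> (('a \<Rightarrow> real) \<Rightarrow> real) \<Rightarrow> bool" where
  "comonotonic_additive M \<rho> \<longleftrightarrow> (\<forall>X\<in>cs_rvs M. \<forall>Y\<in>cs_rvs M.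
     comonotonic M X Y \<longrightarrow> \<rho> (\<lambda>w. X w + Y w) = \<rho> X + \<rho> Y)"

definition mixture :: "real \<Rightarrow> real measure \<Rightarrow> real measure \<Rightarrow> real measure" where
  "mixture l F G = measure_of UNIV (sets borel)
     (\<lambda>A. ennreal l * emeasure F A + ennreal (1 - l) * emeasure G A)"

lemma space_mixture [simp]: "space (mixture l F G) = UNIV"
  and sets_mixture [simp]: "sets (mixture l F G) = sets borel"
  using sets.sigma_sets_eq[of "borel :: real measure"]
  by (simp_all add: mixture_def space_measure_of_conv sets_measure_of_conv)

lemma emeasure_mixture:
  assumes "sets F = sets borel" and "sets G = sets borel" and A: "A \<in> sets borel"
  shows "emeasure (mixture l F G) A = ennreal l * emeasure F A + ennreal (1 - l) * emeasure G A"
proof -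
  have "sigma_algebra UNIV (sets (borel :: real measure))"
    using sets.sigma_algebra_axioms[of "borel :: real measure"] by simp
  moreover have "countably_additive (sets borel)
      (\<lambda>A. ennreal l * emeasure F A + ennreal (1 - l) * emeasure G A)"
    unfolding countably_additive_def
  proof (intro allI impI)
    fix B :: "nat \<Rightarrow> real set"
    assume B: "range B \<subseteq> sets borel" "disjoint_family B"
    have "(\<Sum>i. emeasure F (B i)) = emeasure F (\<Union>i. B i)"
      "(\<Sum>i. emeasure G (B i)) = emeasure G (\<Union>i. B i)"
      using B assms(1,2) by (simp_all add: suminf_emeasure)
    then show "(\<Sum>i. ennreal l * emeasure F (B i) + ennreal (1 - l) * emeasure G (B i)) =
        ennreal l * emeasure F (\<Union>i. B i) + ennreal (1 - l) * emeasure G (\<Union>i. B i)"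
      by (simp add: suminf_add[symmetric] ennreal_suminf_cmult)
  qed
  ultimately show ?thesis
    unfolding mixture_def
    by (intro emeasure_measure_of_sigma) (auto simp: positive_def A)
qed

definition p_quasi_convex :: "'a measure \<Rightarrow> (('a \<Rightarrow> real) \<Rightarrow> real) \<Rightarrow> bool" where
  "p_quasi_convex M \<rho> \<longleftrightarrow> (\<forall>F\<in>cs_distributions. \<forall>G\<in>cs_distributions. \<forall>l\<in>{0..1}.
     on_laws M \<rho> (mixture l F G) \<le> max (on_laws M \<rho> F) (on_laws M \<rho> G))"

definition p_locally_indifferent :: "'a measure \<Rightarrow> (('a \<Rightarrow> real) \<Rightarrow> real) \<Rightarrow> bool" where
  "p_locally_indifferent M \<rho> \<longleftrightarrow> (\<exists>A\<in>sets M. \<exists>B\<in>sets M. measure M A \<noteq> measure M B \<and>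
     \<rho> (indicator A) = \<rho> (indicator B) \<and> \<rho> (indicator B) > \<rho> (\<lambda>_. 0))"

text \<open>Only the lower quantile at level 0 and the upper quantile at level 1 need a special case:
  there the general formulas would be infima of \<open>UNIV\<close> and of the empty set. The upper quantile at
  level 0 and the lower quantile at level 1 are \<open>quantile_zero\<close> and \<open>quantile_one\<close> already.\<close>

definition quantile_zero :: "real measure \<Rightarrow> real" where
  "quantile_zero F = Inf {x. cdf F x > 0}"

definition quantile_one :: "real measure \<Rightarrow> real" where
  "quantile_one F = Inf {x. cdf F x \<ge> 1}"

definition quantile_minus :: "real \<Rightarrow> real measure \<Rightarrow> real" where
  "quantile_minus \<alpha> F = (if \<alpha> = 0 then quantile_zero F else Inf {x. cdf F x \<ge> \<alpha>})"

definition quantile_plus :: "real \<Rightarrow> real measure \<Rightarrow> real" where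
  "quantile_plus \<alpha> F = (if \<alpha> = 1 then quantile_one F else Inf {x. cdf F x > \<alpha>})"

definition quantile_mix :: "real \<Rightarrow> real \<Rightarrow> real measure \<Rightarrow> real" where
  "quantile_mix c \<alpha> F = c * quantile_plus \<alpha> F + (1 - c) * quantile_minus \<alpha> F"

end

theory Submission
  imports Defs
begin

text \<open>A monotone comonotonic-additive functional normalised by \<open>\<rho>(1) = 1\<close> is determined by its
  distortion \<open>h(P(A)) = \<rho>(1\<^sub>A)\<close>: after scaling by a large \<open>n\<close>, a bounded variable is within 1 of a
  comonotonic sum of indicators. Applied to the two-step variables \<open>m 1{U \<le> a\<^sub>1} + n 1{U \<le> a\<^sub>2}\<close>,
  whose laws mix by mixing \<open>(a\<^sub>1, a\<^sub>2)\<close>, quasi-convexity becomes an inequality for \<open>h\<close>. If \<open>h\<close> has a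
  positive plateau \<open>v\<close>, then an increase of \<open>h\<close> before 1 to the right of it, or a value strictly between 0
  and \<open>v\<close> to the left of it, violates this inequality: the step at the plateau's left end pays for the
  mixture in one coordinate while the other coordinate gains. So \<open>h\<close> is 0, then \<open>v\<close>, then 1 at 1, which is
  the distortion of the asserted combination of quantiles.\<close>

subsection \<open>Uniform random variables on nonatomic spaces\<close>

context prob_space begin

text \<open>When a set is split into two pieces of positive mass, one of them carries at most half
  of it. Repeated halving gets below every \<open>e\<close>.\<close>

lemma nonatomic_small_subset:
  assumes na: "nonatomic M" and A: "A \<in> events" "prob A > 0" and e: "e > 0"
  shows "\<exists>B\<in>events. B \<subseteq> A \<and> 0 < prob B \<and> prob B < e"
proof -
  have half: "\<exists>C\<in>events. C \<subseteq> B \<and> 0 < prob C \<and> prob C \<le> prob B / 2"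
    if B: "B \<in> events" "prob B > 0" for B
  proof -
    obtain C where C: "C \<in> events" "C \<subseteq> B" "0 < prob C" "prob C < prob B"
      using na B unfolding nonatomic_def by blast
    have "prob (B - C) = prob B - prob C"
      using B C by (simp add: finite_measure_Diff)
    then have "prob C \<le> prob B / 2 \<or> 0 < prob (B - C) \<and> prob (B - C) \<le> prob B / 2"
      using C by (auto simp: field_simps)
    then show ?thesis
      using B C by (metis Diff_subset sets.Diff)
  qed
  have "\<exists>B\<in>events. B \<subseteq> A \<and> 0 < prob B \<and> prob B \<le> prob A / 2 ^ n" for n :: nat
  proof (induction n)
    case (Suc n)
    then obtain B where B: "B \<in> events" "B \<subseteq> A" "0 < prob B" "prob B \<le> prob A / 2 ^ n"
      by blast
    obtain C where C: "C \<in> events" "C \<subseteq> B" "0 < prob C" "prob C \<le> prob B / 2"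
      using half B by blast
    have "prob C \<le> prob A / 2 ^ Suc n"
      using B(4) C(4) by simp
    then show ?case
      using B(2) C by blast
  qed (use A in auto)
  moreover obtain n :: nat where "(1 / 2) ^ n < e"
    using real_arch_pow_inv[of e "1/2"] e by auto
  then have "prob A / 2 ^ n < e"
    using prob_le_1[of A] by (smt (verit) divide_right_mono power_one_over zero_less_power)
  ultimately show ?thesis
    by (meson le_less_trans)
qed

text \<open>Sierpinski's theorem. Each step of the sequence \<open>B\<close> gains at least half of what an admissible
  set can still gain, so the union leaves nothing to gain.\<close>

lemma nonatomic_intermediate:
  assumes na: "nonatomic M" and AC: "A \<in> events" "C \<in> events" "A \<subseteq> C"
    and t: "prob A \<le> t" "t \<le> prob C"
  shows "\<exists>B\<in>events. A \<subseteq> B \<and> B \<subseteq> C \<and> prob B = t"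
proof -
  define \<D> where "\<D> B = {D \<in> events. B \<subseteq> D \<and> D \<subseteq> C \<and> prob D \<le> t}" for B
  define s where "s B = Sup (prob ` \<D> B)" for B
  have bdd: "bdd_above (prob ` \<D> B)" for B
    by (rule bdd_aboveI[of _ 1]) auto
  define P where "P B \<longleftrightarrow> B \<in> events \<and> A \<subseteq> B \<and> B \<subseteq> C \<and> prob B \<le> t" for B
  have step: "\<exists>D. P D \<and> B \<subseteq> D \<and> (prob B + s B) / 2 \<le> prob D" if B: "P B" for B
  proof (cases "prob B < s B")
    case True
    have "\<D> B \<noteq> {}"
      using B by (auto simp: P_def \<D>_def)
    moreover have "(prob B + s B) / 2 < s B"
      using True by simp
    ultimately obtain D where "D \<in> \<D> B" "(prob B + s B) / 2 < prob D"
      unfolding s_def by (subst (asm) less_cSup_iff[OF _ bdd]) auto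
    then show ?thesis
      using B unfolding P_def \<D>_def by (intro exI[of _ D]) auto
  next
    case False
    then show ?thesis
      using B by (intro exI[of _ B]) auto
  qed
  have "P A"
    using AC t by (auto simp: P_def)
  then obtain B where B: "\<And>n. P (B n)" "\<And>n. B n \<subseteq> B (Suc n)"
      "\<And>n. (prob (B n) + s (B n)) / 2 \<le> prob (B (Suc n))"
    using dependent_nat_choice[of "\<lambda>_. P" "\<lambda>_ B D. B \<subseteq> D \<and> (prob B + s B) / 2 \<le> prob D"] step
    by metis
  define U where "U = (\<Union>n. B n)"
  have ev: "B n \<in> events" for n
    using B(1) by (auto simp: P_def)
  have U: "U \<in> events" "A \<subseteq> U" "U \<subseteq> C"
    using B(1) ev by (auto simp: U_def P_def)
  have lim: "(\<lambda>n. prob (B n)) \<longlonglongrightarrow> prob U"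
    unfolding U_def using ev B(2) by (intro finite_Lim_measure_incseq) (auto simp: incseq_Suc_iff)
  have Ut: "prob U \<le> t"
    using B(1) by (intro LIMSEQ_le_const2[OF lim]) (auto simp: P_def)
  \<comment> \<open>A set admissible for \<open>U\<close> is admissible for every
    \<open>B n\<close>, so \<open>B (Suc n)\<close> has at least the average of
    \<open>prob (B n)\<close> and \<open>prob D\<close>. The limit of these averages yields the
    bound.\<close>
  have max: "prob D \<le> prob U" if D: "D \<in> \<D> U" for D
  proof -
    have "(prob (B n) + prob D) / 2 \<le> prob U" for n
    proof -
      have "D \<in> \<D> (B n)"
        using D by (auto simp: \<D>_def U_def)
      then have "prob D \<le> s (B n)"
        unfolding s_def by (intro cSup_upper bdd) auto
      moreover have "prob (B (Suc n)) \<le> prob U"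
        using U(1) by (intro finite_measure_mono) (auto simp: U_def)
      ultimately show ?thesis
        using B(3)[of n] by argo
    qed
    moreover have "(\<lambda>n. (prob (B n) + prob D) / 2) \<longlonglongrightarrow> (prob U + prob D) / 2"
      by (intro tendsto_intros lim) simp
    ultimately have "(prob U + prob D) / 2 \<le> prob U"
      by (intro LIMSEQ_le_const2) auto
    then show ?thesis by simp
  qed
  have "prob U = t"
  proof (rule ccontr)
    assume "prob U \<noteq> t"
    then have less: "prob U < t"
      using Ut by simp
    \<comment> \<open>If mass is still missing, a piece of \<open>C - U\<close> smaller than the gap
      can be added to \<open>U\<close>, against \<open>max\<close>.\<close>
    have "prob (C - U) > 0"
      using less t U AC by (simp add: finite_measure_Diff)
    then obtain D where D: "D \<in> events" "D \<subseteq> C - U" "0 < prob D" "prob D < t - prob U"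
      using nonatomic_small_subset[OF na, of "C - U" "t - prob U"] U AC less by auto
    have "prob (U \<union> D) = prob U + prob D"
      using D U by (intro finite_measure_Union) auto
    then have "U \<union> D \<in> \<D> U"
      using D U by (auto simp: \<D>_def)
    from max[OF this] show False
      using \<open>prob (U \<union> D) = prob U + prob D\<close> D by simp
  qed
  then show ?thesis
    using U by blast
qed

text \<open>Repeated bisection between the empty set and the whole space gives nested events
  \<open>E n k\<close> of probability \<open>k / 2 ^ n\<close>; \<open>V w\<close> is the infimum of
  the dyadic levels whose event contains \<open>w\<close>. Strict sublevel sets are the convenient
  ones: an infimum is below \<open>t\<close> iff some level is, so \<open>{V < t}\<close> is a
  countable union of these events.\<close>

lemma nonatomic_uniform_strict:
  assumes na: "nonatomic M"
  shows "\<exists>V\<in>borel_measurable M. \<forall>t\<in>{0<..1}. prob {w \<in> space M. V w < t} = t"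
proof -
  have "\<forall>A C. \<exists>B. A \<in> events \<longrightarrow> C \<in> events \<longrightarrow> A \<subseteq> C \<longrightarrow>
      B \<in> events \<and> A \<subseteq> B \<and> B \<subseteq> C \<and> prob B = (prob A + prob C) / 2"
  proof (intro allI)
    fix A C
    show "\<exists>B. A \<in> events \<longrightarrow> C \<in> events \<longrightarrow> A \<subseteq> C \<longrightarrow>
      B \<in> events \<and> A \<subseteq> B \<and> B \<subseteq> C \<and> prob B = (prob A + prob C) / 2"
      using nonatomic_intermediate[OF na, of A C "(prob A + prob C) / 2"]
        finite_measure_mono[of A C] by (cases "A \<in> events \<and> C \<in> events \<and> A \<subseteq> C") auto
  qed
  then obtain mid where mid: "\<And>A C. A \<in> events \<Longrightarrow> C \<in> events \<Longrightarrow> A \<subseteq> C \<Longrightarrow>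
      mid A C \<in> events \<and> A \<subseteq> mid A C \<and> mid A C \<subseteq> C \<and> prob (mid A C) = (prob A + prob C) / 2"
    by metis
  \<comment> \<open>At stage 0 every positive index gets the whole space. Monotonicity in
    \<open>k\<close> thus holds without a bound on \<open>k\<close>, and only the probability
    formula is restricted to \<open>k \<le> 2 ^ n\<close>.\<close>
  define E :: "nat \<Rightarrow> nat \<Rightarrow> 'a set" where "E = rec_nat (\<lambda>k. if k = 0 then {} else space M)
    (\<lambda>n D k. if even k then D (k div 2) else mid (D (k div 2)) (D (Suc (k div 2))))"
  have E0: "E 0 k = (if k = 0 then {} else space M)" for k
    by (simp add: E_def)
  have ES: "E (Suc n) k = (if even k then E n (k div 2)
      else mid (E n (k div 2)) (E n (Suc (k div 2))))" for n k
    by (simp add: E_def)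
  have inv: "(\<forall>k. E n k \<in> events \<and> E n k \<subseteq> E n (Suc k)) \<and> (\<forall>k\<le>2^n. prob (E n k) = k / 2^n)" for n
  proof (induction n)
    case 0
    show ?case by (auto simp: E0 prob_space le_Suc_eq)
  next
    case (Suc n)
    have m: "mid (E n j) (E n (Suc j)) \<in> events \<and> E n j \<subseteq> mid (E n j) (E n (Suc j)) \<and>
        mid (E n j) (E n (Suc j)) \<subseteq> E n (Suc j) \<and>
        prob (mid (E n j) (E n (Suc j))) = (prob (E n j) + prob (E n (Suc j))) / 2" for j
      using mid Suc by blast
    have "E (Suc n) k \<in> events \<and> E (Suc n) k \<subseteq> E (Suc n) (Suc k)" for k
      using m Suc by (auto simp: ES elim!: evenE oddE)
    moreover have "prob (E (Suc n) k) = k / 2 ^ Suc n" if "k \<le> 2 ^ Suc n" for k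
    proof (cases "even k")
      case True
      then obtain j where "k = 2 * j" by (auto elim: evenE)
      then show ?thesis using Suc that by (simp add: ES)
    next
      case False
      then obtain j where j: "k = 2 * j + 1" by (auto elim: oddE)
      then have "Suc j \<le> 2 ^ n" using that by simp
      then have "prob (E n j) = j / 2 ^ n" "prob (E n (Suc j)) = Suc j / 2 ^ n"
        using Suc by auto
      then have "prob (E (Suc n) k) = (j / 2 ^ n + Suc j / 2 ^ n) / 2"
        using j m[of j] by (simp add: ES)
      then show ?thesis using j by (simp add: field_simps)
    qed
    ultimately show ?case by blast
  qed
  have E_ev [measurable]: "E n k \<in> events" and E_mono: "E n k \<subseteq> E n (Suc k)" for n k
    using inv by blast+
  have E_prob: "prob (E n k) = k / 2 ^ n" if "k \<le> 2 ^ n" for n k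
    using inv that by blast
  \<comment> \<open>Refinement keeps the event attached to a dyadic level, so events from stages
    \<open>n\<close> and \<open>m\<close> can be compared at stage \<open>n + m\<close>.\<close>
  have lift: "E (n + d) (k * 2 ^ d) = E n k" for n d k
    by (induction d) (simp_all add: ES mult.commute mult.left_commute)
  have sub: "E n k \<subseteq> E m j" if "real k / 2 ^ n \<le> real j / 2 ^ m" for n k m j
  proof -
    have "real (k * 2 ^ m) \<le> real (j * 2 ^ n)"
      using that by (simp add: field_simps)
    then have "k * 2 ^ m \<le> j * 2 ^ n"
      by linarith
    then have "E (n + m) (k * 2 ^ m) \<subseteq> E (n + m) (j * 2 ^ n)"
      by (rule lift_Suc_mono_le[of "E (n + m)", OF E_mono])
    then show ?thesis
      using lift[of n m k] lift[of m n j] by (simp add: add.commute)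
  qed
  define V where "V w = Inf {real k / 2 ^ n |n k. w \<in> E n k}" for w
  have V_less: "V w < t \<longleftrightarrow> (\<exists>n k. w \<in> E n k \<and> real k / 2 ^ n < t)" if "w \<in> space M" for w t
  proof -
    have "w \<in> E 0 1" using that by (simp add: E0)
    then have "{real k / 2 ^ n |n k. w \<in> E n k} \<noteq> {}" by blast
    moreover have "bdd_below {real k / 2 ^ n |n k. w \<in> E n k}"
      by (rule bdd_belowI[of _ 0]) auto
    ultimately show ?thesis
      unfolding V_def using cInf_less_iff by (smt (verit, ccfv_threshold) mem_Collect_eq)
  qed
  have V_set: "{w \<in> space M. V w < t} = (\<Union>n. \<Union>k\<in>{k. real k / 2 ^ n < t}. E n k)" for t
    using V_less sets.sets_into_space[OF E_ev] by fastforce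
  have ev: "{w \<in> space M. V w < t} \<in> events" for t
    unfolding V_set by (intro sets.countable_UN' E_ev) auto
  then have "V \<in> borel_measurable M"
    by (simp add: borel_measurable_iff_less)
  moreover have "prob {w \<in> space M. V w < t} = t" if t: "t \<in> {0<..1}" for t
  proof -
    let ?p = "prob {w \<in> space M. V w < t}"
    have "\<bar>?p - t\<bar> \<le> (1/2) ^ n" for n
    proof -
      \<comment> \<open>The largest integer strictly below \<open>t * 2 ^ n\<close>. Then
        \<open>k / 2 ^ n < t \<le> (k + 1) / 2 ^ n\<close>, and \<open>{V < t}\<close> is squeezed
        between two consecutive events.\<close>
      define k where "k = nat (\<lceil>t * 2 ^ n\<rceil> - 1)"
      have "t * 2 ^ n > 0" using t by simp
      then have k': "real k = \<lceil>t * 2 ^ n\<rceil> - 1"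
        unfolding k_def by (simp add: less_ceiling_iff)
      then have k: "real k < t * 2 ^ n" "t * 2 ^ n \<le> real (Suc k)"
        by linarith+
      have "t * 2 ^ n \<le> 2 ^ n" using t by simp
      then have "real k < 2 ^ n" using k by linarith
      then have le: "Suc k \<le> 2 ^ n" by (simp add: Suc_le_eq)
      have "real k / 2 ^ n < t" "t \<le> real (Suc k) / 2 ^ n"
        using k by (simp_all add: field_simps)
      note kk = this
      have "E n k \<subseteq> {w \<in> space M. V w < t}"
        unfolding V_set using kk by auto
      then have "prob (E n k) \<le> ?p"
        using ev by (intro finite_measure_mono)
      moreover have "{w \<in> space M. V w < t} \<subseteq> E n (Suc k)"
      proof -
        have "E m j \<subseteq> E n (Suc k)" if "real j / 2 ^ m < t" for m j
          using that kk by (intro sub) linarith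
        then show ?thesis
          unfolding V_set by blast
      qed
      then have "?p \<le> prob (E n (Suc k))"
        by (intro finite_measure_mono) auto
      ultimately have "k / 2 ^ n \<le> ?p" "?p \<le> Suc k / 2 ^ n"
        using E_prob[of k n] E_prob[OF le] le by simp_all
      moreover have "real (Suc k) / 2 ^ n = k / 2 ^ n + (1/2) ^ n"
        by (simp add: field_simps)
      ultimately show ?thesis
        using kk by linarith
    qed
    moreover have "(\<lambda>n. (1/2) ^ n :: real) \<longlonglongrightarrow> 0"
      by (intro LIMSEQ_power_zero) auto
    ultimately have "\<bar>?p - t\<bar> \<le> 0"
      by (intro LIMSEQ_le_const) auto
    then show ?thesis by simp
  qed
  ultimately show ?thesis by blast
qed

text \<open>Passes from strict to weak sublevel sets and modifies \<open>V\<close> on a null set, so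
  that the values lie strictly inside the unit interval everywhere, as the quantile transform
  requires.\<close>

lemma nonatomic_uniform:
  assumes na: "nonatomic M"
  obtains U where "U \<in> borel_measurable M" "\<And>w. 0 < U w \<and> U w < (1::real)"
    "\<And>t. 0 \<le> t \<Longrightarrow> t \<le> 1 \<Longrightarrow> prob {w \<in> space M. U w \<le> t} = t"
proof -
  obtain V where V [measurable]: "V \<in> borel_measurable M"
    and less: "\<And>t. 0 < t \<Longrightarrow> t \<le> 1 \<Longrightarrow> prob {w \<in> space M. V w < t} = t"
    using nonatomic_uniform_strict[OF na] by auto
  have le_less: "prob {w \<in> space M. V w \<le> s} \<le> t" if "s < t" "0 < t" "t \<le> 1" for s t
  proof -
    have "prob {w \<in> space M. V w \<le> s} \<le> prob {w \<in> space M. V w < t}"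
      using that by (intro finite_measure_mono) auto
    then show ?thesis
      using less[OF that(2,3)] by simp
  qed
  have le: "prob {w \<in> space M. V w \<le> t} = t" if t: "0 \<le> t" "t < 1" for t
  proof (rule antisym)
    \<comment> \<open>\<open>{V \<le> t}\<close> lies in \<open>{V < t'}\<close> for each
      \<open>t'\<close> strictly between \<open>t\<close> and 1, so its probability is at most every
      such \<open>t'\<close>.\<close>
    show "prob {w \<in> space M. V w \<le> t} \<le> t"
      using t by (intro dense_ge_bounded[of t 1]) (auto intro!: le_less)
    have "prob {w \<in> space M. V w < t} \<le> prob {w \<in> space M. V w \<le> t}"
      by (intro finite_measure_mono) auto
    then show "t \<le> prob {w \<in> space M. V w \<le> t}"
      using less[of t] t by (cases "t = 0") auto
  qed
  have AE: "AE w in M. 0 < V w \<and> V w < 1"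
  proof -
    have "AE w in M. \<not> V w \<le> 0"
      using le[of 0] by (subst prob_Collect_eq_0[symmetric]) auto
    moreover have "AE w in M. V w < 1"
      using less[of 1] by (subst prob_Collect_eq_1[symmetric]) auto
    ultimately show ?thesis
      by eventually_elim auto
  qed
  define U where "U w = (if 0 < V w \<and> V w < 1 then V w else 1/2)" for w
  have U [measurable]: "U \<in> borel_measurable M"
    unfolding U_def by measurable
  have U01: "0 < U w \<and> U w < 1" for w
    by (simp add: U_def)
  moreover have "prob {w \<in> space M. U w \<le> t} = t" if "0 \<le> t" "t \<le> 1" for t
  proof (cases "t = 1")
    case True
    then have "{w \<in> space M. U w \<le> t} = space M"
      using U01 less_imp_le by auto
    then show ?thesis using True by (simp add: prob_space)
  next
    case False
    have "prob {w \<in> space M. U w \<le> t} = prob {w \<in> space M. V w \<le> t}"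
      using AE by (intro finite_measure_eq_AE) (auto simp: U_def)
    then show ?thesis using le[of t] that False by simp
  qed
  ultimately show ?thesis
    using that[of U] U by blast
qed

end

subsection \<open>Generalized quantiles\<close>

text \<open>All quantiles involved are infima of points where the distribution function enters an
  upward closed set of levels, so their properties can be proved once for a general
  \<open>P\<close>. The conditions at 1 and 0 make that infimum run over a nonempty set bounded
  below.\<close>

definition up_level :: "(real \<Rightarrow> bool) \<Rightarrow> bool" where
  "up_level P \<longleftrightarrow> (\<forall>a b. a \<le> b \<longrightarrow> P a \<longrightarrow> P b) \<and> P 1 \<and> \<not> P 0"

definition level_quantile :: "(real \<Rightarrow> bool) \<Rightarrow> real measure \<Rightarrow> real" where
  "level_quantile P F = Inf {x. P (cdf F x)}"

text \<open>At level 1 a strict threshold would violate \<open>P 1\<close>; the closed one matches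
  the convention for \<open>quantile_plus\<close>.\<close>

definition upper_level :: "real \<Rightarrow> real \<Rightarrow> bool" where
  "upper_level \<alpha> p \<longleftrightarrow> (if \<alpha> = 1 then 1 \<le> p else \<alpha> < p)"

lemma up_levelD: "up_level P \<Longrightarrow> a \<le> b \<Longrightarrow> P a \<Longrightarrow> P b"
  unfolding up_level_def by blast

lemma up_level_01: "up_level P \<Longrightarrow> P 1" "up_level P \<Longrightarrow> \<not> P 0"
  unfolding up_level_def by blast+

lemma up_level_less [intro, simp]: "up_level ((<) 0)"
  and up_level_le [intro]: "0 < \<alpha> \<Longrightarrow> \<alpha> \<le> 1 \<Longrightarrow> up_level ((\<le>) \<alpha>)"
  and up_level_upper [intro]: "0 < \<alpha> \<Longrightarrow> \<alpha> \<le> 1 \<Longrightarrow> up_level (upper_level \<alpha>)"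
  by (auto simp: up_level_def upper_level_def)

lemma quantile_zero_eq: "quantile_zero F = level_quantile ((<) 0) F"
  by (simp add: quantile_zero_def level_quantile_def)

lemma quantile_minus_eq: "0 < \<alpha> \<Longrightarrow> quantile_minus \<alpha> F = level_quantile ((\<le>) \<alpha>) F"
  by (simp add: quantile_minus_def level_quantile_def)

lemma quantile_plus_eq: "quantile_plus \<alpha> F = level_quantile (upper_level \<alpha>) F"
  by (simp add: quantile_plus_def quantile_one_def level_quantile_def upper_level_def)

lemma cs_distributions_cdf:
  assumes "F \<in> cs_distributions"
  obtains N where "\<And>x. x < -N \<Longrightarrow> cdf F x = 0" "\<And>x. N \<le> x \<Longrightarrow> cdf F x = 1"
proof -
  from assms obtain K where F: "real_distribution F" and K: "compact K" "measure F K = 1"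
    by (auto simp: cs_distributions_def)
  interpret real_distribution F by fact
  obtain N where N: "\<And>x. x \<in> K \<Longrightarrow> \<bar>x\<bar> \<le> N"
    using compact_imp_bounded[OF K(1)] by (auto simp: bounded_iff)
  have "K \<in> sets borel"
    using K(1) by (simp add: compact_imp_closed borel_closed)
  then have K_ev: "K \<in> events" by simp
  have "cdf F x = 1" if "N \<le> x" for x
  proof -
    have "measure F K \<le> measure F {..x}"
      using N that by (intro finite_measure_mono) force+
    then show ?thesis
      using K prob_le_1[of "{..x}"] by (simp add: cdf_def)
  qed
  moreover have "cdf F x = 0" if "x < -N" for x
  proof -
    have "measure F {..x} \<le> measure F (space F - K)"
      using N that by (intro finite_measure_mono sets.compl_sets K_ev) force
    also have "\<dots> = 0"
      using K K_ev by (subst prob_compl) auto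
    finally show ?thesis
      by (simp add: cdf_def measure_le_0_iff)
  qed
  ultimately show ?thesis using that by blast
qed

context
  fixes F P
  assumes F: "F \<in> cs_distributions" and P: "up_level P"
begin

lemma level_set_nonempty: "{x. P (cdf F x)} \<noteq> {}"
proof -
  obtain N where "\<And>x. N \<le> x \<Longrightarrow> cdf F x = 1"
    using cs_distributions_cdf[OF F] by metis
  then have "P (cdf F N)" using up_level_01[OF P] by simp
  then show ?thesis by blast
qed

lemma level_set_bdd_below: "bdd_below {x. P (cdf F x)}"
proof -
  obtain N where "\<And>x. x < -N \<Longrightarrow> cdf F x = 0"
    using cs_distributions_cdf[OF F] by metis
  then show ?thesis
    using P by (intro bdd_belowI[of _ "-N"]) (metis linorder_not_less mem_Collect_eq up_level_01(2))
qed

text \<open>The infimum need not be attained, for instance with a strict threshold. Hence this lemma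
  and the next compare only with points strictly on one side of the quantile.\<close>

lemma level_quantile_lessD:
  assumes "level_quantile P F < x"
  shows "P (cdf F x)"
proof -
  interpret real_distribution F
    using F by (auto simp: cs_distributions_def)
  obtain y where "y < x" "P (cdf F y)"
    using assms cInf_less_iff[OF level_set_nonempty level_set_bdd_below]
    by (auto simp: level_quantile_def)
  then show ?thesis
    using up_levelD[OF P] cdf_nondecreasing[of y x] by auto
qed

lemma less_level_quantileD: "x < level_quantile P F \<Longrightarrow> \<not> P (cdf F x)"
  using cInf_lower[OF _ level_set_bdd_below, of x] by (auto simp: level_quantile_def)

lemma level_quantile_leI: "(\<And>x. b < x \<Longrightarrow> P (cdf F x)) \<Longrightarrow> level_quantile P F \<le> b"
  using less_level_quantileD by (meson dense not_le)

lemma level_quantile_geI: "(\<And>x. x < b \<Longrightarrow> \<not> P (cdf F x)) \<Longrightarrow> b \<le> level_quantile P F"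
  using level_quantile_lessD by (meson dense not_le)

end

lemma level_quantile_mono:
  assumes "F \<in> cs_distributions" "G \<in> cs_distributions" "up_level P" "\<And>x. cdf G x \<le> cdf F x"
  shows "level_quantile P F \<le> level_quantile P G"
  using assms level_quantile_lessD[of G P] by (intro level_quantile_leI) (auto intro: up_levelD)

lemma
  assumes F: "F \<in> cs_distributions" and G: "G \<in> cs_distributions" and l: "0 \<le> l" "l \<le> 1"
  shows mixture_cs_distributions: "mixture l F G \<in> cs_distributions"
    and cdf_mixture: "cdf (mixture l F G) x = l * cdf F x + (1 - l) * cdf G x"
proof -
  interpret F: real_distribution F using F by (auto simp: cs_distributions_def)
  interpret G: real_distribution G using G by (auto simp: cs_distributions_def)
  have em: "emeasure (mixture l F G) A = ennreal (l * measure F A + (1 - l) * measure G A)"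
    if "A \<in> sets borel" for A
    using l that by (subst emeasure_mixture)
      (auto simp: F.emeasure_eq_measure G.emeasure_eq_measure ennreal_mult' ennreal_plus)
  have m: "measure (mixture l F G) A = l * measure F A + (1 - l) * measure G A"
    if "A \<in> sets borel" for A
    using l em[OF that] by (intro measure_eq_emeasure_eq_ennreal) auto
  show "cdf (mixture l F G) x = l * cdf F x + (1 - l) * cdf G x"
    unfolding cdf_def by (rule m) simp
  obtain K L where K: "compact K" "measure F K = 1" and L: "compact L" "measure G L = 1"
    using F G by (auto simp: cs_distributions_def)
  have b: "K \<in> sets borel" "L \<in> sets borel"
    using K L by (auto simp: compact_imp_closed borel_closed)
  have "measure F (K \<union> L) = 1"
    using K b F.finite_measure_mono[of K "K \<union> L"] F.prob_le_1[of "K \<union> L"] by simp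
  moreover have "measure G (K \<union> L) = 1"
    using L b G.finite_measure_mono[of L "K \<union> L"] G.prob_le_1[of "K \<union> L"] by simp
  ultimately have "measure (mixture l F G) (K \<union> L) = 1"
    using b by (simp add: m)
  moreover have "prob_space (mixture l F G)"
    using em[of UNIV] F.prob_space G.prob_space by (intro prob_spaceI) simp
  then have "real_distribution (mixture l F G)"
    by (simp add: real_distribution_def real_distribution_axioms_def)
  ultimately show "mixture l F G \<in> cs_distributions"
    using K L compact_Un by (auto simp: cs_distributions_def)
qed

section \<open>Compactly supported random variables and their quantiles\<close>

context prob_space begin

lemma cs_rvs_iff: "X \<in> cs_rvs M \<longleftrightarrow> X \<in> borel_measurable M \<and> (\<exists>N. AE w in M. \<bar>X w\<bar> \<le> N)"
proof (cases "X \<in> borel_measurable M")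
  case X: True
  interpret D: real_distribution "distr M borel X"
    using X by (rule real_distribution_distr)
  have "(\<exists>K. compact K \<and> measure (distr M borel X) K = 1) \<longleftrightarrow> (\<exists>N. AE w in M. \<bar>X w\<bar> \<le> N)"
  proof (intro iffI; elim exE conjE)
    fix K assume K: "compact K" "measure (distr M borel X) K = 1"
    obtain N where N: "\<And>x. x \<in> K \<Longrightarrow> \<bar>x\<bar> \<le> N"
      using compact_imp_bounded[OF K(1)] by (auto simp: bounded_iff)
    have "K \<in> sets borel"
      using K(1) by (simp add: compact_imp_closed borel_closed)
    then have "AE x in distr M borel X. x \<in> K"
      using K D.prob_eq_1 by simp
    then have "AE w in M. X w \<in> K"
      using X by (simp add: AE_distr_iff \<open>K \<in> sets borel\<close>)
    then have "AE w in M. \<bar>X w\<bar> \<le> N"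
      by eventually_elim (use N in auto)
    then show "\<exists>N. AE w in M. \<bar>X w\<bar> \<le> N" ..
  next
    fix N assume "AE w in M. \<bar>X w\<bar> \<le> N"
    then have "AE w in M. X w \<in> {-N..N}"
      by eventually_elim auto
    then have "AE x in distr M borel X. x \<in> {-N..N}"
      using X by (subst AE_distr_iff) auto
    then have "measure (distr M borel X) {-N..N} = 1"
      using D.prob_eq_1[of "{-N..N}"] by simp
    then show "\<exists>K. compact K \<and> measure (distr M borel X) K = 1"
      by blast
  qed
  then show ?thesis
    using X real_distribution_distr[OF X] by (simp add: cs_rvs_def cs_distributions_def)
qed (simp add: cs_rvs_def)

lemma cs_rvs_distr: "X \<in> cs_rvs M \<Longrightarrow> distr M borel X \<in> cs_distributions"
  by (simp add: cs_rvs_def)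

lemma bounded_cs_rvs:
  "X \<in> borel_measurable M \<Longrightarrow> (\<And>w. w \<in> space M \<Longrightarrow> \<bar>X w\<bar> \<le> N) \<Longrightarrow> X \<in> cs_rvs M"
  by (auto simp: cs_rvs_iff intro!: exI[of _ N] AE_I2)

lemma const_cs_rvs: "(\<lambda>_. c) \<in> cs_rvs M"
  by (rule bounded_cs_rvs[of _ "\<bar>c\<bar>"]) auto

lemma indicator_cs_rvs: "A \<in> events \<Longrightarrow> indicator A \<in> cs_rvs M"
  by (rule bounded_cs_rvs[of _ 1]) (auto simp: indicator_def)

lemma add_cs_rvs:
  assumes "X \<in> cs_rvs M" "Y \<in> cs_rvs M"
  shows "(\<lambda>w. X w + Y w) \<in> cs_rvs M"
proof -
  obtain N K where "AE w in M. \<bar>X w\<bar> \<le> N" "AE w in M. \<bar>Y w\<bar> \<le> K"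
    using assms by (auto simp: cs_rvs_iff)
  then have "AE w in M. \<bar>X w + Y w\<bar> \<le> N + K"
    by eventually_elim linarith
  then show ?thesis
    using assms by (auto simp: cs_rvs_iff)
qed

lemma cdf_distr_rv:
  "X \<in> borel_measurable M \<Longrightarrow> cdf (distr M borel X) x = prob {w \<in> space M. X w \<le> x}"
  by (simp add: cdf_def measure_distr vimage_def Int_def conj_commute)

text \<open>Truncation at an essential bound changes \<open>X\<close> only on a null set. A bound
  valid at every point is what the later approximation by sums of indicators asks for.\<close>

lemma cs_rvs_bounded_version:
  assumes "X \<in> cs_rvs M"
  obtains Y and N :: nat where "Y \<in> cs_rvs M" "distr M borel Y = distr M borel X" "\<And>w. \<bar>Y w\<bar> \<le> real N"
proof -
  have X [measurable]: "X \<in> borel_measurable M"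
    using assms by (simp add: cs_rvs_iff)
  obtain K where K: "AE w in M. \<bar>X w\<bar> \<le> K"
    using assms by (auto simp: cs_rvs_iff)
  obtain N :: nat where N: "K \<le> real N"
    using real_arch_simple by blast
  define Y where "Y w = max (- real N) (min (real N) (X w))" for w
  have Y [measurable]: "Y \<in> borel_measurable M"
    unfolding Y_def by measurable
  have bd: "\<bar>Y w\<bar> \<le> real N" for w
    by (auto simp: Y_def)
  have "AE w in M. Y w = X w"
    using K by eventually_elim (use N in \<open>auto simp: Y_def\<close>)
  then have "distr M borel Y = distr M borel X"
    by (intro distr_cong_AE) auto
  moreover have "Y \<in> cs_rvs M"
    using bd by (intro bounded_cs_rvs) auto
  ultimately show ?thesis using that bd by blast
qed

text \<open>Up to a null set, sublevel sets of comonotonic variables are nested, so intersection and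
  union have the probabilities of the two sets themselves.\<close>

lemma comonotonic_nested:
  fixes x y :: real
  assumes [measurable]: "X \<in> borel_measurable M" "Y \<in> borel_measurable M" and co: "comonotonic M X Y"
  defines "a \<equiv> prob {w \<in> space M. X w \<le> x}" and "b \<equiv> prob {w \<in> space M. Y w \<le> y}"
    and "c \<equiv> prob {w \<in> space M. X w \<le> x \<and> Y w \<le> y}"
    and "d \<equiv> prob {w \<in> space M. X w \<le> x \<or> Y w \<le> y}"
  shows "c = a \<and> d = b \<or> c = b \<and> d = a"
proof -
  obtain S where S: "S \<in> events" "prob S = 1"
      "\<And>w w'. w \<in> S \<Longrightarrow> w' \<in> S \<Longrightarrow> (X w - X w') * (Y w - Y w') \<ge> 0"
    using co by (auto simp: comonotonic_def)
  have AE: "AE w in M. w \<in> S"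
    using S by (simp add: prob_eq_1)
  have "(\<forall>w\<in>S. X w \<le> x \<longrightarrow> Y w \<le> y) \<or> (\<forall>w\<in>S. Y w \<le> y \<longrightarrow> X w \<le> x)"
  proof (rule ccontr)
    assume "\<not> ?thesis"
    \<comment> \<open>A point in each of the two set differences would order \<open>X\<close> and
      \<open>Y\<close> oppositely.\<close>
    then obtain w w' where w: "w \<in> S" "w' \<in> S" "X w \<le> x" "y < Y w" "Y w' \<le> y" "x < X w'"
      by (auto simp: not_le)
    then have "(X w - X w') * (Y w - Y w') < 0"
      by (intro mult_neg_pos) auto
    then show False using S(3)[OF w(1,2)] by simp
  qed
  then show ?thesis
  proof
    assume *: "\<forall>w\<in>S. X w \<le> x \<longrightarrow> Y w \<le> y"
    have "c = a" "d = b"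
      unfolding a_def b_def c_def d_def using AE * by (auto intro!: finite_measure_eq_AE)
    then show ?thesis by blast
  next
    assume *: "\<forall>w\<in>S. Y w \<le> y \<longrightarrow> X w \<le> x"
    have "c = b" "d = a"
      unfolding a_def b_def c_def d_def using AE * by (auto intro!: finite_measure_eq_AE)
    then show ?thesis by blast
  qed
qed

text \<open>Half of the slack goes to each summand. The upper bound uses the intersection of two
  sublevel sets and the lower bound their union; by nestedness each has the probability of one of
  the two sets, to which \<open>P\<close> or its negation already applies.\<close>

lemma level_quantile_comonotonic_add:
  assumes X: "X \<in> cs_rvs M" and Y: "Y \<in> cs_rvs M" and co: "comonotonic M X Y" and P: "up_level P"
  shows "level_quantile P (distr M borel (\<lambda>w. X w + Y w)) =
    level_quantile P (distr M borel X) + level_quantile P (distr M borel Y)" (is "?z = ?x + ?y")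
proof (rule antisym)
  have m [measurable]: "X \<in> borel_measurable M" "Y \<in> borel_measurable M"
    using X Y by (auto simp: cs_rvs_iff)
  note nested = comonotonic_nested[OF m co]
  note Z = cs_rvs_distr[OF add_cs_rvs[OF X Y]]
  show "?z \<le> ?x + ?y"
  proof (rule level_quantile_leI[OF Z P])
    fix z assume z: "?x + ?y < z"
    define e where "e = (z - ?x - ?y) / 2"
    have "0 < e" using z by (simp add: e_def)
    then have "P (cdf (distr M borel X) (?x + e))" "P (cdf (distr M borel Y) (?y + e))"
      using level_quantile_lessD[OF cs_rvs_distr[OF X] P] level_quantile_lessD[OF cs_rvs_distr[OF Y] P]
      by simp_all
    then have "P (prob {w \<in> space M. X w \<le> ?x + e \<and> Y w \<le> ?y + e})"
      using nested[of "?x + e" "?y + e"] by (auto simp: cdf_distr_rv m)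
    moreover have "prob {w \<in> space M. X w \<le> ?x + e \<and> Y w \<le> ?y + e} \<le>
        prob {w \<in> space M. X w + Y w \<le> z}"
      by (intro finite_measure_mono) (auto simp: e_def field_simps)
    ultimately show "P (cdf (distr M borel (\<lambda>w. X w + Y w)) z)"
      using up_levelD[OF P] by (simp add: cdf_distr_rv)
  qed
  show "?x + ?y \<le> ?z"
  proof (rule level_quantile_geI[OF Z P])
    fix z assume z: "z < ?x + ?y"
    define e where "e = (?x + ?y - z) / 2"
    have "0 < e" using z by (simp add: e_def)
    then have "\<not> P (cdf (distr M borel X) (?x - e))" "\<not> P (cdf (distr M borel Y) (?y - e))"
      using less_level_quantileD[OF cs_rvs_distr[OF X] P] less_level_quantileD[OF cs_rvs_distr[OF Y] P]
      by simp_all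
    then have "\<not> P (prob {w \<in> space M. X w \<le> ?x - e \<or> Y w \<le> ?y - e})"
      using nested[of "?x - e" "?y - e"] by (auto simp: cdf_distr_rv m)
    moreover have "prob {w \<in> space M. X w + Y w \<le> z} \<le>
        prob {w \<in> space M. X w \<le> ?x - e \<or> Y w \<le> ?y - e}"
      by (intro finite_measure_mono) (auto simp: e_def field_simps)
    ultimately show "\<not> P (cdf (distr M borel (\<lambda>w. X w + Y w)) z)"
      using up_levelD[OF P] by (auto simp: cdf_distr_rv)
  qed
qed

lemma level_quantile_mono_rv:
  assumes X: "X \<in> cs_rvs M" and Y: "Y \<in> cs_rvs M" and le: "\<And>w. w \<in> space M \<Longrightarrow> X w \<le> Y w"
    and P: "up_level P"
  shows "level_quantile P (distr M borel X) \<le> level_quantile P (distr M borel Y)"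
proof -
  have m [measurable]: "X \<in> borel_measurable M" "Y \<in> borel_measurable M"
    using X Y by (auto simp: cs_rvs_iff)
  have "cdf (distr M borel Y) x \<le> cdf (distr M borel X) x" for x
    unfolding cdf_distr_rv[OF m(1)] cdf_distr_rv[OF m(2)]
    using le by (intro finite_measure_mono) (auto intro: order_trans)
  then show ?thesis
    using X Y P by (intro level_quantile_mono cs_rvs_distr)
qed

lemma cdf_indicator:
  assumes A: "A \<in> events"
  shows "cdf (distr M borel (indicator A)) x = (if x < 0 then 0 else if x < 1 then 1 - prob A else 1)"
proof -
  have "{w \<in> space M. indicat_real A w \<le> x} =
      (if x < 0 then {} else if x < 1 then space M - A else space M)"
    by (auto simp: indicator_def)
  then show ?thesis
    using A by (simp add: cdf_distr_rv prob_compl prob_space)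
qed

text \<open>This makes the distortion well defined: a law-based functional sees only the probability
  of an event.\<close>

lemma distr_indicator_cong:
  assumes "A \<in> events" "B \<in> events" "prob A = prob B"
  shows "distr M borel (indicat_real A) = distr M borel (indicator B)"
  using assms by (intro cdf_unique real_distribution_distr) (auto simp: cdf_indicator fun_eq_iff)

lemma level_quantile_indicator:
  assumes A: "A \<in> events" and P: "up_level P"
  shows "level_quantile P (distr M borel (indicator A)) = (if P (1 - prob A) then 0 else 1)"
proof -
  note D = cs_rvs_distr[OF indicator_cs_rvs[OF A]]
  have "level_quantile P (distr M borel (indicator A)) \<le> (if P (1 - prob A) then 0 else 1)"
    using up_level_01[OF P] by (intro level_quantile_leI[OF D P]) (auto simp: cdf_indicator A split: if_splits)
  moreover have "(if P (1 - prob A) then 0 else 1) \<le> level_quantile P (distr M borel (indicator A))"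
    using up_level_01[OF P] by (intro level_quantile_geI[OF D P]) (auto simp: cdf_indicator A split: if_splits)
  ultimately show ?thesis by (rule antisym)
qed

text \<open>The quantile transform: the generalized inverse of the distribution function, applied to
  a uniform variable, has the given law.\<close>

lemma nonatomic_representative:
  assumes na: "nonatomic M" and F: "F \<in> cs_distributions"
  obtains X where "X \<in> cs_rvs M" "distr M borel X = F"
proof -
  interpret F: real_distribution F
    using F by (auto simp: cs_distributions_def)
  interpret F: cdf_distribution F ..
  obtain U where U [measurable]: "U \<in> borel_measurable M" and U01: "\<And>w. 0 < U w \<and> U w < 1"
    and Ule: "\<And>t. 0 \<le> t \<Longrightarrow> t \<le> 1 \<Longrightarrow> prob {w \<in> space M. U w \<le> t} = t"
    using nonatomic_uniform[OF na] by blast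
  define X where "X w = F.I (U w)" for w
  have le: "X w \<le> x \<longleftrightarrow> U w \<le> cdf F x" for w x
    using F.pseudoinverse[of "U w" x] U01 by (simp add: X_def)
  have X [measurable]: "X \<in> borel_measurable M"
    unfolding borel_measurable_iff_le le by auto
  have "distr M borel X = F"
  proof (rule cdf_unique)
    show "real_distribution (distr M borel X)"
      using X by simp
    show "cdf (distr M borel X) = cdf F"
      by (rule ext) (simp add: cdf_distr_rv le Ule F.cdf_nonneg F.cdf_bounded_prob)
  qed (rule F.real_distribution_axioms)
  moreover from this have "X \<in> cs_rvs M"
    using X F by (simp add: cs_rvs_def)
  ultimately show ?thesis using that by blast
qed

lemma on_laws_representative:
  assumes na: "nonatomic M" and lb: "law_based M \<rho>" and F: "F \<in> cs_distributions"
  obtains X where "X \<in> cs_rvs M" "distr M borel X = F" "on_laws M \<rho> F = \<rho> X"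
  using nonatomic_representative[OF na F] on_laws_distr[OF lb] by metis

end

subsection \<open>Monotone comonotonic-additive functionals\<close>

text \<open>Monotonicity is taken pointwise: it follows from the stochastic order by
  \<open>fosd_monotone_rv\<close> and is easily checked for quantiles.\<close>

definition comonotonic_functional :: "'a measure \<Rightarrow> (('a \<Rightarrow> real) \<Rightarrow> real) \<Rightarrow> bool" where
  "comonotonic_functional M \<rho> \<longleftrightarrow> law_based M \<rho> \<and> comonotonic_additive M \<rho> \<and> \<rho> (\<lambda>_. 1) = 1 \<and>
    (\<forall>X\<in>cs_rvs M. \<forall>Y\<in>cs_rvs M. (\<forall>w\<in>space M. X w \<le> Y w) \<longrightarrow> \<rho> X \<le> \<rho> Y)"

context prob_space begin

text \<open>Two variables that are both nondecreasing in a common \<open>Z\<close> are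
  comonotonic.\<close>

lemma comonotonicI:
  assumes "\<And>w w'. w \<in> space M \<Longrightarrow> w' \<in> space M \<Longrightarrow> (Z w :: real) \<le> Z w' \<Longrightarrow> X w \<le> X w' \<and> Y w \<le> Y w'"
  shows "comonotonic M X Y"
  unfolding comonotonic_def
proof (intro bexI[of _ "space M"] conjI ballI)
  fix w w' assume w: "w \<in> space M" "w' \<in> space M"
  show "0 \<le> (X w - X w') * (Y w - Y w')"
  proof (cases "Z w \<le> Z w'")
    case True
    then show ?thesis
      using assms[OF w] by (intro mult_nonpos_nonpos) auto
  next
    case False
    then show ?thesis
      using assms[OF w(2,1)] by (intro mult_nonneg_nonneg) auto
  qed
qed (auto simp: prob_space)

context
  fixes \<rho>
  assumes \<rho>: "comonotonic_functional M \<rho>"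
begin

lemma cf_add: "X \<in> cs_rvs M \<Longrightarrow> Y \<in> cs_rvs M \<Longrightarrow> comonotonic M X Y \<Longrightarrow>
    \<rho> (\<lambda>w. X w + Y w) = \<rho> X + \<rho> Y"
  using \<rho> by (simp add: comonotonic_functional_def comonotonic_additive_def)

lemma cf_mono: "X \<in> cs_rvs M \<Longrightarrow> Y \<in> cs_rvs M \<Longrightarrow> (\<And>w. w \<in> space M \<Longrightarrow> X w \<le> Y w) \<Longrightarrow> \<rho> X \<le> \<rho> Y"
  using \<rho> by (simp add: comonotonic_functional_def)

lemma cf_law: "X \<in> cs_rvs M \<Longrightarrow> Y \<in> cs_rvs M \<Longrightarrow> distr M borel X = distr M borel Y \<Longrightarrow> \<rho> X = \<rho> Y"
  using \<rho> unfolding comonotonic_functional_def law_based_def by blast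

lemma cf_one: "\<rho> (\<lambda>_. 1) = 1"
  using \<rho> by (simp add: comonotonic_functional_def)

lemma cf_zero: "\<rho> (\<lambda>_. 0) = 0"
  using cf_add[OF const_cs_rvs const_cs_rvs, of 0 0] comonotonicI[of "\<lambda>_. 0" "\<lambda>_. 0" "\<lambda>_. 0"] by simp

text \<open>A multiple of \<open>X\<close> is comonotonic with \<open>X\<close>, so additivity gives
  homogeneity for integer factors by induction.\<close>

lemma cf_nat_mult:
  assumes "X \<in> cs_rvs M"
  shows "(\<lambda>w. real n * X w) \<in> cs_rvs M \<and> \<rho> (\<lambda>w. real n * X w) = real n * \<rho> X"
proof (induction n)
  case 0
  then show ?case by (simp add: cf_zero const_cs_rvs)
next
  case (Suc n)
  have "comonotonic M (\<lambda>w. real n * X w) X"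
    by (rule comonotonicI[of X]) (auto intro: mult_left_mono)
  with Suc show ?case
    using cf_add[of "\<lambda>w. real n * X w" X] add_cs_rvs[of "\<lambda>w. real n * X w" X] assms
    by (simp add: algebra_simps)
qed

lemma cf_add_nat:
  assumes "X \<in> cs_rvs M"
  shows "(\<lambda>w. X w + real n) \<in> cs_rvs M \<and> \<rho> (\<lambda>w. X w + real n) = \<rho> X + real n"
proof -
  have "\<rho> (\<lambda>_. real n) = real n"
    using cf_nat_mult[OF const_cs_rvs, of n 1] cf_one by simp
  then show ?thesis
    using cf_add[OF assms const_cs_rvs] add_cs_rvs[OF assms const_cs_rvs] comonotonicI[of X X "\<lambda>_. real n"]
    by simp
qed

text \<open>The sum of the indicators of \<open>{Y \<ge> i}\<close> for \<open>i \<ge> 1\<close> is the integer part of \<open>Y\<close>, and its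
  summands are comonotonic.\<close>

lemma cf_indicator_sum_approx:
  assumes Y: "Y \<in> cs_rvs M" and bd: "\<And>w. w \<in> space M \<Longrightarrow> 0 \<le> Y w \<and> Y w \<le> real K"
  shows "\<bar>\<rho> Y - (\<Sum>i=1..K. \<rho> (indicator {w \<in> space M. real i \<le> Y w}))\<bar> \<le> 1"
proof -
  define I :: "nat \<Rightarrow> 'a \<Rightarrow> real" where "I i = indicator {w \<in> space M. real i \<le> Y w}" for i
  define S where "S j w = (\<Sum>i=1..j. I i w)" for j :: nat and w
  have m [measurable]: "Y \<in> borel_measurable M"
    using Y by (simp add: cs_rvs_iff)
  have I: "I i \<in> cs_rvs M" for i
    unfolding I_def by (rule indicator_cs_rvs) simp
  have I_mono: "I i w \<le> I i w'" if "w \<in> space M" "w' \<in> space M" "Y w \<le> Y w'" for i w w'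
    using that by (auto simp: I_def indicator_def)
  have S: "S j \<in> cs_rvs M \<and> \<rho> (S j) = (\<Sum>i=1..j. \<rho> (I i))" for j
  proof (induction j)
    case 0
    have "S 0 = (\<lambda>_. 0)" by (simp add: S_def fun_eq_iff)
    then show ?case by (simp add: cf_zero const_cs_rvs)
  next
    case (Suc j)
    have S_Suc: "S (Suc j) = (\<lambda>w. S j w + I (Suc j) w)"
      by (simp add: S_def fun_eq_iff)
    have "comonotonic M (S j) (I (Suc j))"
      by (rule comonotonicI[of Y]) (auto simp: S_def intro!: sum_mono I_mono)
    with Suc show ?case
      using cf_add[of "S j" "I (Suc j)"] add_cs_rvs[of "S j" "I (Suc j)"] I by (simp add: S_Suc)
  qed
  \<comment> \<open>The alternative \<open>S j w = real j\<close> covers points where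
    \<open>Y\<close> exceeds the number of summands so far. At \<open>j = K\<close> it gives
    \<open>Y w \<le> S K w\<close> because \<open>Y\<close> is bounded by \<open>K\<close>.\<close>
  have floor: "S j w \<le> Y w \<and> S j w \<le> real j \<and> (Y w < S j w + 1 \<or> S j w = real j)"
    if w: "w \<in> space M" for j w
  proof (induction j)
    case 0
    then show ?case using bd[OF w] by (simp add: S_def)
  next
    case (Suc j)
    have "S (Suc j) w = S j w + (if real (Suc j) \<le> Y w then 1 else 0)"
      using w by (simp add: S_def I_def indicator_def)
    with Suc show ?case by (auto split: if_splits)
  qed
  have "S K w \<le> Y w" if "w \<in> space M" for w
    using floor[OF that, of K] by blast
  then have "\<rho> (S K) \<le> \<rho> Y"
    using S[of K] Y by (intro cf_mono) auto
  moreover have "Y w \<le> S K w + real 1" if "w \<in> space M" for w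
    using floor[OF that, of K] bd[OF that] by auto
  then have "\<rho> Y \<le> \<rho> (\<lambda>w. S K w + real 1)"
    using cf_add_nat[of "S K" 1] S[of K] Y by (intro cf_mono) auto
  ultimately show ?thesis
    using S[of K] cf_add_nat[of "S K" 1] by (simp add: I_def abs_le_iff)
qed

end

text \<open>Both functionals differ by at most 1 from the same sum of indicator values, whatever the
  scale. Scaling by \<open>n\<close> therefore bounds \<open>n\<close> times their difference by 2
  for every \<open>n\<close>.\<close>

theorem comonotonic_functional_eqI:
  assumes \<rho>: "comonotonic_functional M \<rho>" and \<sigma>: "comonotonic_functional M \<sigma>"
    and eq: "\<And>A. A \<in> events \<Longrightarrow> \<rho> (indicator A) = \<sigma> (indicator A)" and X: "X \<in> cs_rvs M"
  shows "\<rho> X = \<sigma> X"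
proof -
  obtain Y and N :: nat where Y: "Y \<in> cs_rvs M" "distr M borel Y = distr M borel X"
    and bd: "\<And>w. \<bar>Y w\<bar> \<le> real N"
    using cs_rvs_bounded_version[OF X] by blast
  have [measurable]: "Y \<in> borel_measurable M"
    using Y by (simp add: cs_rvs_iff)
  have "real n * \<bar>\<rho> Y - \<sigma> Y\<bar> \<le> 2" for n
  proof -
    \<comment> \<open>The shift by \<open>n * N\<close> moves the values of the scaled variable into
      the interval from 0 to \<open>2 * n * N\<close>, where the integer part is a sum of
      indicators.\<close>
    define Z where "Z = (\<lambda>w. real n * Y w + real (n * N))"
    have nY: "(\<lambda>w. real n * Y w) \<in> cs_rvs M"
      using cf_nat_mult[OF \<rho> Y(1)] by blast
    then have Z: "Z \<in> cs_rvs M"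
      using cf_add_nat[OF \<rho>] unfolding Z_def by blast
    then have [measurable]: "Z \<in> borel_measurable M"
      by (simp add: cs_rvs_iff)
    have val: "\<tau> Z = real n * \<tau> Y + real (n * N)" if "comonotonic_functional M \<tau>" for \<tau>
      using cf_add_nat[OF that nY, of "n * N"] cf_nat_mult[OF that Y(1), of n] by (simp add: Z_def)
    have "0 \<le> Z w \<and> Z w \<le> real (2 * (n * N))" for w
    proof -
      have "\<bar>real n * Y w\<bar> \<le> real n * real N"
        using bd[of w] by (simp add: abs_mult mult_left_mono)
      then show ?thesis
        unfolding Z_def of_nat_mult of_nat_numeral by linarith
    qed
    then have "\<bar>\<tau> Z - (\<Sum>i=1..2 * (n * N). \<tau> (indicator {w \<in> space M. real i \<le> Z w}))\<bar> \<le> 1"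
      if "comonotonic_functional M \<tau>" for \<tau>
      using cf_indicator_sum_approx[OF that Z] by blast
    from this[OF \<rho>] this[OF \<sigma>] have "\<bar>\<rho> Z - \<sigma> Z\<bar> \<le> 2"
      by (simp add: eq)
    moreover have "\<rho> Z - \<sigma> Z = real n * (\<rho> Y - \<sigma> Y)"
      using val[OF \<rho>] val[OF \<sigma>] by (simp add: algebra_simps)
    ultimately show ?thesis by (simp add: abs_mult)
  qed
  then have "\<not> 0 < \<bar>\<rho> Y - \<sigma> Y\<bar>"
    using reals_Archimedean3[of "\<bar>\<rho> Y - \<sigma> Y\<bar>"] by (meson not_le)
  then show ?thesis
    using cf_law[OF \<rho> Y(1) X Y(2)] cf_law[OF \<sigma> Y(1) X Y(2)] by simp
qed

text \<open>Increasing functions preserve the pointwise order and are bounded on the essential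
  range, so their expectations exist and are ordered.\<close>

lemma fosd_monotone_rv:
  assumes lb: "law_based M \<rho>" and fosd: "fosd_monotone M \<rho>"
    and X: "X \<in> cs_rvs M" and Y: "Y \<in> cs_rvs M" and le: "\<And>w. w \<in> space M \<Longrightarrow> X w \<le> Y w"
  shows "\<rho> X \<le> \<rho> Y"
proof -
  have m [measurable]: "X \<in> borel_measurable M" "Y \<in> borel_measurable M"
    using X Y by (auto simp: cs_rvs_iff)
  have "(\<integral>x. f x \<partial>distr M borel X) \<le> (\<integral>x. f x \<partial>distr M borel Y)" if f: "mono f" for f :: "real \<Rightarrow> real"
  proof -
    have f_m [measurable]: "f \<in> borel_measurable borel"
      using f by (rule borel_measurable_mono)
    have int: "integrable M (\<lambda>w. f (Z w))" if Z: "Z \<in> cs_rvs M" for Z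
    proof -
      have [measurable]: "Z \<in> borel_measurable M"
        using Z by (simp add: cs_rvs_iff)
      obtain N where "AE w in M. \<bar>Z w\<bar> \<le> N"
        using Z by (auto simp: cs_rvs_iff)
      then have "AE w in M. norm (f (Z w)) \<le> \<bar>f N\<bar> + \<bar>f (-N)\<bar>"
      proof eventually_elim
        case (elim w)
        then have "f (-N) \<le> f (Z w)" "f (Z w) \<le> f N"
          using f by (auto intro: monoD)
        then show ?case by simp
      qed
      then show ?thesis
        by (rule integrable_const_bound) measurable
    qed
    show ?thesis
      using f le int[OF X] int[OF Y] by (simp add: integral_distr integral_mono monoD)
  qed
  then have "on_laws M \<rho> (distr M borel X) \<le> on_laws M \<rho> (distr M borel Y)"
    using fosd cs_rvs_distr[OF X] cs_rvs_distr[OF Y] by (simp add: fosd_monotone_def)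
  then show ?thesis
    by (simp add: on_laws_distr[OF lb] X Y)
qed

lemma comonotonic_functional_step:
  assumes \<rho>: "comonotonic_functional M \<rho>" and qc: "p_quasi_convex M \<rho>"
    and U [measurable]: "U \<in> borel_measurable M"
    and Ule: "\<And>t. 0 \<le> t \<Longrightarrow> t \<le> 1 \<Longrightarrow> prob {w \<in> space M. U w \<le> t} = t"
    and a: "0 \<le> a2" "a2 \<le> a1" "a1 \<le> 1" and b: "0 \<le> b2" "b2 \<le> b1" "b1 \<le> 1" and l: "0 \<le> l" "l \<le> 1"
  defines "h \<equiv> \<lambda>p. \<rho> (indicator {w \<in> space M. U w \<le> p})"
  shows "real m * h (l * a1 + (1 - l) * b1) + real n * h (l * a2 + (1 - l) * b2)
    \<le> max (real m * h a1 + real n * h a2) (real m * h b1 + real n * h b2)"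
proof -
  let ?I = "\<lambda>p. indicator {w \<in> space M. U w \<le> p} :: 'a \<Rightarrow> real"
  define X where "X p q w = real m * ?I p w + real n * ?I q w" for p q w
  have I: "?I p \<in> cs_rvs M" for p
    by (rule indicator_cs_rvs) simp
  note mI = cf_nat_mult[OF \<rho> I, of m] and nI = cf_nat_mult[OF \<rho> I, of n]
  have X: "X p q \<in> cs_rvs M" for p q
    unfolding X_def using mI nI by (intro add_cs_rvs) auto
  then have X_m [measurable]: "X p q \<in> borel_measurable M" for p q
    by (simp add: cs_rvs_iff)
  have val: "\<rho> (X p q) = real m * h p + real n * h q" for p q
  proof -
    \<comment> \<open>Both indicators are nonincreasing in \<open>U\<close>, hence nondecreasing in
      \<open>- U\<close>.\<close>
    have "comonotonic M (\<lambda>w. real m * ?I p w) (\<lambda>w. real n * ?I q w)"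
      by (rule comonotonicI[of "\<lambda>w. - U w"]) (auto simp: indicator_def)
    then show ?thesis
      unfolding X_def h_def using cf_add[OF \<rho>, of "\<lambda>w. real m * ?I p w" "\<lambda>w. real n * ?I q w"] mI nI by simp
  qed
  \<comment> \<open>For \<open>q \<le> p\<close> the values are 0, \<open>m\<close> and
    \<open>m + n\<close>. At each \<open>x\<close> the distribution function is affine in
    \<open>(p, q)\<close>, which is why mixing laws means mixing parameters.\<close>
  have cdf: "cdf (distr M borel (X p q)) x = (if x < 0 then 0 else if x < real m then 1 - p
      else if x < real m + real n then 1 - q else 1)" if "0 \<le> q" "q \<le> p" "p \<le> 1" for p q x
  proof -
    have "{w \<in> space M. X p q w \<le> x} = (if x < 0 then {} else if x < real m then space M - {w \<in> space M. U w \<le> p}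
      else if x < real m + real n then space M - {w \<in> space M. U w \<le> q} else space M)"
    proof -
      have "X p q w = (if U w \<le> q then real m + real n else if U w \<le> p then real m else 0)"
        if "w \<in> space M" for w
        using that \<open>q \<le> p\<close> by (auto simp: X_def)
      then show ?thesis
        using \<open>q \<le> p\<close> by (auto split: if_splits)
    qed
    then show ?thesis
      using that by (simp add: cdf_distr_rv prob_compl Ule prob_space)
  qed
  define m1 where "m1 = l * a1 + (1 - l) * b1"
  define m2 where "m2 = l * a2 + (1 - l) * b2"
  have m12: "0 \<le> m2" "m2 \<le> m1" "m1 \<le> 1"
    unfolding m1_def m2_def using a b l convex_bound_le[of a1 1 b1 l "1 - l"]
    by (simp_all add: add_mono mult_left_mono)
  note D = cs_rvs_distr[OF X]
  have mixture: "mixture l (distr M borel (X a1 a2)) (distr M borel (X b1 b2)) = distr M borel (X m1 m2)"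
  proof (rule cdf_unique)
    show "real_distribution (mixture l (distr M borel (X a1 a2)) (distr M borel (X b1 b2)))"
      using mixture_cs_distributions[OF D D l] by (simp add: cs_distributions_def)
    show "cdf (mixture l (distr M borel (X a1 a2)) (distr M borel (X b1 b2))) = cdf (distr M borel (X m1 m2))"
    proof
      fix x
      show "cdf (mixture l (distr M borel (X a1 a2)) (distr M borel (X b1 b2))) x = cdf (distr M borel (X m1 m2)) x"
        unfolding cdf_mixture[OF D D l] cdf[OF a] cdf[OF b] cdf[OF m12]
        by (simp add: m1_def m2_def algebra_simps)
    qed
  qed simp
  have lb: "law_based M \<rho>"
    using \<rho> by (simp add: comonotonic_functional_def)
  have "on_laws M \<rho> (mixture l (distr M borel (X a1 a2)) (distr M borel (X b1 b2)))
      \<le> max (on_laws M \<rho> (distr M borel (X a1 a2))) (on_laws M \<rho> (distr M borel (X b1 b2)))"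
    using qc l D[of a1 a2] D[of b1 b2] unfolding p_quasi_convex_def by simp
  then show ?thesis
    unfolding mixture on_laws_distr[OF lb X] by (simp add: val m1_def m2_def)
qed

end

subsection \<open>Distortions with a plateau\<close>

text \<open>The mixing inequality is applied with \<open>a1 \<in> {1, q}\<close>, \<open>a2 = 0\<close>, \<open>b1 = b2\<close>. Large
  multiplicities \<open>m\<close>, \<open>n\<close> turn a gain at the mixed point into a contradiction.\<close>

lemma two_step_distortion:
  fixes h :: "real \<Rightarrow> real"
  assumes h0: "h 0 = 0" and h1: "h 1 = 1"
    and mono: "\<And>x y. 0 \<le> x \<Longrightarrow> x \<le> y \<Longrightarrow> y \<le> 1 \<Longrightarrow> h x \<le> h y"
    and mix: "\<And>a1 a2 b1 b2 l (m::nat) (n::nat).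
      0 \<le> a2 \<Longrightarrow> a2 \<le> a1 \<Longrightarrow> a1 \<le> 1 \<Longrightarrow> 0 \<le> b2 \<Longrightarrow> b2 \<le> b1 \<Longrightarrow> b1 \<le> 1 \<Longrightarrow> 0 \<le> l \<Longrightarrow> l \<le> 1 \<Longrightarrow>
      real m * h (l * a1 + (1 - l) * b1) + real n * h (l * a2 + (1 - l) * b2)
        \<le> max (real m * h a1 + real n * h a2) (real m * h b1 + real n * h b2)"
    and pq: "0 \<le> p" "p < q" "q \<le> 1" "h p = h q" "0 < h q"
  obtains s v where "0 \<le> s" "s < 1" "0 < v" "v \<le> 1" "0 \<le> h s" "h s \<le> v"
    "\<And>x. 0 \<le> x \<Longrightarrow> x < s \<Longrightarrow> h x = 0" "\<And>x. s < x \<Longrightarrow> x < 1 \<Longrightarrow> h x = v"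
proof -
  define v where "v = h q"
  define A where "A = {x. 0 \<le> x \<and> x \<le> 1 \<and> h x = v}"
  \<comment> \<open>The left end of the plateau. Whether \<open>s\<close> lies on it stays
    open.\<close>
  define s where "s = Inf A"
  have v: "0 < v" "v \<le> 1"
    using pq mono[of q 1] h1 by (auto simp: v_def)
  have pA: "p \<in> A"
    using pq by (simp add: A_def v_def)
  have bdd: "bdd_below A"
    by (rule bdd_belowI[of _ 0]) (simp add: A_def)
  have s: "0 \<le> s" "s \<le> p"
    unfolding s_def using pA bdd by (auto intro!: cInf_greatest cInf_lower simp: A_def)
  have "A \<noteq> {}"
    using pA by blast
  note less_s = cInf_less_iff[OF this bdd]
  have flat: "h x = v" if sx: "s < x" and xq: "x \<le> q" for x
  proof -
    obtain y where "y \<in> A" "y < x"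
      using sx less_s[of x] by (auto simp: s_def)
    then have "v \<le> h x" "h x \<le> v"
      using mono[of y x] mono[of x q] xq pq by (auto simp: A_def v_def)
    then show ?thesis by simp
  qed
  have below: "h x < v" if "0 \<le> x" "x < s" for x
  proof -
    have "x \<notin> A"
      using that cInf_lower[OF _ bdd, of x] by (auto simp: s_def)
    then show ?thesis
      using mono[of x p] that s pq by (auto simp: A_def v_def)
  qed
  have zero: "h x = 0" if x: "0 \<le> x" "x < s" for x
  proof (rule ccontr)
    assume "h x \<noteq> 0"
    then have hx: "0 < h x"
      using mono[of 0 x] h0 x s pq by simp
    \<comment> \<open>With this weight \<open>(1 - l) * s\<close> is the midpoint of
      \<open>x\<close> and \<open>s\<close>, which leaves room for \<open>t\<close> between
      \<open>x\<close> and \<open>(1 - l) * s\<close>.\<close>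
    define l where "l = (s - x) / (2 * s)"
    have l: "0 < l" "l < 1"
      using x by (auto simp: l_def field_simps)
    have ls: "(1 - l) * s = (s + x) / 2"
      using x by (simp add: l_def field_simps)
    have "0 < l * q" using l pq by simp
    moreover have "s * l < q * l"
      using l s pq by (intro mult_strict_right_mono) auto
    ultimately have "max x (s - l * q) < (1 - l) * s"
      using ls x by (simp add: algebra_simps)
    \<comment> \<open>\<open>x < t\<close> keeps the value at the second mixed coordinate at least
      \<open>h x\<close>; \<open>s - l * q < t\<close> puts the first one on the plateau;
      \<open>t < (1 - l) * s\<close> keeps \<open>b\<close> to the left of \<open>s\<close>.\<close>
    then obtain t where t: "max x (s - l * q) < t" "t < (1 - l) * s"
      using dense by blast
    define b where "b = t / (1 - l)"
    have b: "(1 - l) * b = t" "0 \<le> b" "b < s"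
      using t l x by (auto simp: b_def field_simps)
    have hb: "h b < v"
      using below b by simp
    have "l * q + (1 - l) * b \<le> l * q + (1 - l) * q"
      using b s pq l by (intro add_left_mono mult_left_mono) auto
    then have "l * q + (1 - l) * b \<le> q"
      by (simp add: algebra_simps)
    then have hm1: "h (l * q + (1 - l) * b) = v"
      using t b by (intro flat) auto
    have "t \<le> 1"
      using t(2) ls x s pq by simp
    then have hm2: "h x \<le> h ((1 - l) * b)"
      using b t x by (intro mono) auto
    \<comment> \<open>This makes \<open>n * v\<close> exceed \<open>(n + 1) * h b\<close>. The
      maximum below is then \<open>n * v\<close>, while the mixture reaches at least
      \<open>n * v + h x\<close>.\<close>
    obtain n :: nat where n: "h b < real n * (v - h b)"
      using reals_Archimedean3[of "v - h b"] hb by auto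
    have "real n * h (l * q + (1 - l) * b) + real 1 * h (l * 0 + (1 - l) * b)
        \<le> max (real n * h q + real 1 * h 0) (real n * h b + real 1 * h b)"
      using b s pq l by (intro mix) auto
    then have "real n * v + h x \<le> max (real n * v) (real n * h b + h b)"
      using hm1 hm2 h0 by (simp add: v_def)
    then show False
      using hx n by (auto simp: algebra_simps max_def split: if_splits)
  qed
  have above: "h x = v" if x: "q \<le> x" "x < 1" for x
  proof -
    \<comment> \<open>Now \<open>(1 - l) * q\<close> is the midpoint of \<open>s\<close> and
      \<open>q\<close>, so shrinking a point \<open>b \<ge> q\<close> by the factor
      \<open>1 - l\<close> does not leave the plateau.\<close>
    define l where "l = (q - s) / (2 * q)"
    have l: "0 < l" "l < 1" "(1 - l) * q = (q + s) / 2"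
      using s pq by (auto simp: l_def field_simps)
    have step: "h (l + (1 - l) * b) = v" if b: "q \<le> b" "b \<le> 1" "h b = v" for b
    proof (rule ccontr)
      assume "h (l + (1 - l) * b) \<noteq> v"
      moreover have "l * b \<le> l * 1" "(1 - l) * b \<le> (1 - l) * 1" "0 \<le> (1 - l) * b"
        using b l pq by (auto intro!: mult_left_mono)
      then have m1: "b \<le> l + (1 - l) * b" "l + (1 - l) * b \<le> 1"
        by (auto simp: algebra_simps)
      ultimately have gt: "v < h (l + (1 - l) * b)"
        using mono[OF _ m1] b pq by simp
      have "(1 - l) * q \<le> (1 - l) * b"
        using b l by (intro mult_left_mono) auto
      moreover have "(1 - l) * b \<le> b"
        using l b pq by (simp add: mult_left_le_one_le)
      moreover from this have "(1 - l) * b \<le> 1"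
        using b by simp
      ultimately have "h ((1 - l) * q) \<le> h ((1 - l) * b)" "h ((1 - l) * b) \<le> h b"
        using b l pq by (auto intro!: mono)
      moreover have "h ((1 - l) * q) = v"
        using l(3) s pq by (intro flat) (simp_all only: l(3), simp_all)
      ultimately have hm2: "h ((1 - l) * b) = v"
        using b by simp
      \<comment> \<open>With \<open>n * v > 1\<close> the maximum below is \<open>v + n * v\<close>.
        The second coordinate contributes \<open>n * v\<close> on both sides, so the first cannot
        exceed \<open>v\<close>.\<close>
      obtain n :: nat where n: "1 < real n * v"
        using reals_Archimedean3[of v] v by auto
      have "real 1 * h (l * 1 + (1 - l) * b) + real n * h (l * 0 + (1 - l) * b)
          \<le> max (real 1 * h 1 + real n * h 0) (real 1 * h b + real n * h b)"
        using b l pq by (intro mix) auto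
      then have "h (l + (1 - l) * b) + real n * v \<le> max 1 (v + real n * v)"
        using hm2 h0 h1 b by simp
      then show False
        using gt n v by (auto simp: max_def split: if_splits)
    qed
    \<comment> \<open>Closed form of the iterates of the map from \<open>b\<close> to
      \<open>l + (1 - l) * b\<close>, started at \<open>q\<close>. They converge to 1, so the
      plateau reaches every \<open>x < 1\<close>.\<close>
    have iter: "q \<le> 1 - (1 - l) ^ n * (1 - q) \<and> 1 - (1 - l) ^ n * (1 - q) \<le> 1 \<and>
        h (1 - (1 - l) ^ n * (1 - q)) = v" for n
    proof (induction n)
      case 0
      then show ?case using pq by (simp add: v_def)
    next
      case (Suc n)
      have "(1 - l) ^ Suc n \<le> 1"
        using l by (intro power_le_one) auto
      then have "(1 - l) ^ Suc n * (1 - q) \<le> 1 * (1 - q)"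
        using pq by (intro mult_right_mono) auto
      moreover have "0 \<le> (1 - l) ^ Suc n * (1 - q)"
        using l pq by (intro mult_nonneg_nonneg) auto
      moreover have "1 - (1 - l) ^ Suc n * (1 - q) = l + (1 - l) * (1 - (1 - l) ^ n * (1 - q))"
        by (simp add: algebra_simps)
      ultimately show ?case
        using step Suc by auto
    qed
    obtain n where n: "(1 - l) ^ n < 1 - x"
      using real_arch_pow_inv[of "1 - x" "1 - l"] x l by auto
    have "(1 - l) ^ n * (1 - q) \<le> (1 - l) ^ n * 1"
      using l pq by (intro mult_left_mono) auto
    then have "x \<le> 1 - (1 - l) ^ n * (1 - q)"
      using n by simp
    then have "h x \<le> v"
      using mono[of x "1 - (1 - l) ^ n * (1 - q)"] iter[of n] x pq by simp
    moreover have "v \<le> h x"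
      using mono[of q x] x pq by (simp add: v_def)
    ultimately show ?thesis by simp
  qed
  show ?thesis
  proof (rule that[of s v])
    show "0 \<le> h s"
      using mono[of 0 s] h0 s pq by simp
    show "h s \<le> v"
      using mono[of s p] s pq by (simp add: v_def)
    show "h x = v" if "s < x" "x < 1" for x
      using that flat above by (cases "x \<le> q") auto
  qed (use s pq v zero in auto)
qed

subsection \<open>Combinations of quantiles\<close>

definition quantile_functional :: "real \<Rightarrow> real \<Rightarrow> real \<Rightarrow> real measure \<Rightarrow> real" where
  "quantile_functional c \<alpha> k F = k * quantile_mix c \<alpha> F + (1 - k) * quantile_zero F"

context
  fixes c \<alpha> k :: real
  assumes c: "0 \<le> c" "c \<le> 1" and \<alpha>: "0 < \<alpha>" "\<alpha> \<le> 1" and k: "0 \<le> k" "k \<le> 1"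
begin

lemma quantile_functional_eq:
  "quantile_functional c \<alpha> k F = k * (c * level_quantile (upper_level \<alpha>) F +
    (1 - c) * level_quantile ((\<le>) \<alpha>) F) + (1 - k) * level_quantile ((<) 0) F"
  using \<alpha> by (simp add: quantile_functional_def quantile_mix_def quantile_zero_eq
    quantile_minus_eq quantile_plus_eq)

lemma quantile_functional_leI:
  assumes "\<And>P. P \<in> {upper_level \<alpha>, (\<le>) \<alpha>, (<) 0} \<Longrightarrow> level_quantile P F \<le> level_quantile P G"
  shows "quantile_functional c \<alpha> k F \<le> quantile_functional c \<alpha> k G"
  unfolding quantile_functional_eq using assms c k
  by (intro add_mono mult_left_mono) simp_all

lemma up_levels: "P \<in> {upper_level \<alpha>, (\<le>) \<alpha>, (<) 0} \<Longrightarrow> up_level P"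
  using \<alpha> by auto

text \<open>Whichever of \<open>F\<close>, \<open>G\<close> has the larger lower \<open>\<alpha>\<close>-quantile dominates the mixture in all
  three quantiles at once.\<close>

lemma quantile_functional_mixture_le:
  assumes F: "F \<in> cs_distributions" and G: "G \<in> cs_distributions" and l: "0 \<le> l" "l < 1"
    and le: "level_quantile ((\<le>) \<alpha>) F \<le> level_quantile ((\<le>) \<alpha>) G"
  shows "quantile_functional c \<alpha> k (mixture l F G) \<le> quantile_functional c \<alpha> k G"
proof (rule quantile_functional_leI)
  fix P assume P: "P \<in> {upper_level \<alpha>, (\<le>) \<alpha>, (<) 0}"
  have l1: "l \<le> 1" using l by simp
  note H = mixture_cs_distributions[OF F G l(1) l1]
  interpret F: real_distribution F using F by (auto simp: cs_distributions_def)
  have low: "up_level ((\<le>) \<alpha>)" using \<alpha> by blast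
  show "level_quantile P (mixture l F G) \<le> level_quantile P G"
  proof (rule level_quantile_leI[OF H up_levels[OF P]])
    fix x assume x: "level_quantile P G < x"
    then have PG: "P (cdf G x)"
      by (rule level_quantile_lessD[OF G up_levels[OF P]])
    \<comment> \<open>For both thresholds at level \<alpha>, \<open>x\<close> lies beyond the lower
      quantile of \<open>G\<close>, hence beyond that of \<open>F\<close>.\<close>
    have \<alpha>_le: "\<alpha> \<le> cdf F x" if "P \<noteq> (<) 0"
    proof -
      have "level_quantile ((\<le>) \<alpha>) G \<le> level_quantile P G"
      proof (rule level_quantile_leI[OF G low])
        fix y assume "level_quantile P G < y"
        then have "P (cdf G y)"
          by (rule level_quantile_lessD[OF G up_levels[OF P]])
        then show "\<alpha> \<le> cdf G y"
          using that P by (auto simp: upper_level_def split: if_splits)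
      qed
      then show ?thesis
        using level_quantile_lessD[OF F low, of x] le x by linarith
    qed
    have mix: "a \<le> l * cdf F x + (1 - l) * cdf G x" if "a \<le> cdf F x" "a \<le> cdf G x" for a
    proof -
      have "l * a + (1 - l) * a \<le> l * cdf F x + (1 - l) * cdf G x"
        using that l by (intro add_mono mult_left_mono) auto
      then show ?thesis by (simp add: algebra_simps)
    qed
    \<comment> \<open>Strictness comes from \<open>G\<close> alone, whose weight
      \<open>1 - l\<close> is positive. With \<open>a = 0\<close> this settles the quantile at level
      0.\<close>
    have mix_less: "a < l * cdf F x + (1 - l) * cdf G x" if "a \<le> cdf F x" "a < cdf G x" for a
    proof -
      have "l * a + (1 - l) * a < l * cdf F x + (1 - l) * cdf G x"
        using that l by (intro add_le_less_mono mult_left_mono mult_strict_left_mono) auto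
      then show ?thesis by (simp add: algebra_simps)
    qed
    have "P (l * cdf F x + (1 - l) * cdf G x)"
    proof (cases "P = (<) 0")
      case True
      then show ?thesis
        using PG mix_less[of 0] F.cdf_nonneg by simp
    next
      case False
      then show ?thesis
        using P PG mix[of \<alpha>] mix_less[of \<alpha>] \<alpha>_le by (auto simp: upper_level_def split: if_splits)
    qed
    then show "P (cdf (mixture l F G) x)"
      by (simp add: cdf_mixture[OF F G l(1) l1])
  qed
qed

lemma quantile_functional_quasi_convex:
  assumes F: "F \<in> cs_distributions" and G: "G \<in> cs_distributions" and l: "0 \<le> l" "l \<le> 1"
  shows "quantile_functional c \<alpha> k (mixture l F G) \<le>
    max (quantile_functional c \<alpha> k F) (quantile_functional c \<alpha> k G)"
proof -
  have cong: "quantile_functional c \<alpha> k A = quantile_functional c \<alpha> k B" if "cdf A = cdf B" for A B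
    using that by (simp add: quantile_functional_eq level_quantile_def)
  have l': "0 \<le> 1 - l" "1 - l \<le> 1"
    using l by auto
  have swap: "cdf (mixture l F G) = cdf (mixture (1 - l) G F)"
    by (rule ext) (simp add: cdf_mixture[OF F G l] cdf_mixture[OF G F l'])
  \<comment> \<open>The endpoints are separate because \<open>quantile_functional_mixture_le\<close>
    gives the dominating law positive weight. For \<open>0 < l < 1\<close> the roles of
    \<open>F\<close> and \<open>G\<close> may be swapped, since quantiles see only the distribution
    function.\<close>
  consider "l = 0" | "l = 1" | "0 < l" "l < 1"
    using l by linarith
  then show ?thesis
  proof cases
    case 1
    then have "cdf (mixture l F G) = cdf G"
      using cdf_mixture[OF F G l] by auto
    then show ?thesis
      using cong by (metis max.cobounded2)
  next
    case 2
    then have "cdf (mixture l F G) = cdf F"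
      using cdf_mixture[OF F G l] by auto
    then show ?thesis
      using cong by (metis max.cobounded1)
  next
    case 3
    show ?thesis
    proof (cases "level_quantile ((\<le>) \<alpha>) F \<le> level_quantile ((\<le>) \<alpha>) G")
      case True
      then show ?thesis
        using quantile_functional_mixture_le[OF F G _ _ True, of l] 3 by simp
    next
      case False
      then have ge: "level_quantile ((\<le>) \<alpha>) G \<le> level_quantile ((\<le>) \<alpha>) F"
        by simp
      then show ?thesis
        using quantile_functional_mixture_le[OF G F _ _ ge, of "1 - l"] 3 cong[OF swap] by simp
    qed
  qed
qed

text \<open>The distortion of the combination: 0 for \<open>p < 1 - \<alpha>\<close>,
  \<open>k\<close> strictly between \<open>1 - \<alpha>\<close> and 1, and 1 at
  \<open>p = 1\<close>. At \<open>p = 1 - \<alpha>\<close> it is \<open>k * c\<close> if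
  \<open>\<alpha> < 1\<close> and 0 if \<open>\<alpha> = 1\<close>.\<close>

lemma quantile_functional_indicator:
  assumes "prob_space M" and A: "A \<in> sets M"
  defines "p \<equiv> measure M A"
  shows "quantile_functional c \<alpha> k (distr M borel (indicator A)) =
    k * (c * (if upper_level \<alpha> (1 - p) then 0 else 1) + (1 - c) * (if \<alpha> \<le> 1 - p then 0 else 1)) +
    (1 - k) * (if p < 1 then 0 else 1)"
proof -
  interpret prob_space M by fact
  show ?thesis
    using \<alpha> by (simp add: quantile_functional_eq level_quantile_indicator[OF A] up_level_le up_level_upper p_def)
qed

lemma quantile_functional_comonotonic:
  assumes "prob_space M"
  shows "comonotonic_functional M (\<lambda>X. quantile_functional c \<alpha> k (distr M borel X))"
proof -
  interpret prob_space M by fact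
  have "quantile_functional c \<alpha> k (distr M borel (\<lambda>w. X w + Y w)) =
      quantile_functional c \<alpha> k (distr M borel X) + quantile_functional c \<alpha> k (distr M borel Y)"
    if "X \<in> cs_rvs M" "Y \<in> cs_rvs M" "comonotonic M X Y" for X Y
    using level_quantile_comonotonic_add[OF that up_levels]
    by (simp add: quantile_functional_eq) (simp add: algebra_simps)
  moreover have "quantile_functional c \<alpha> k (distr M borel X) \<le> quantile_functional c \<alpha> k (distr M borel Y)"
    if "X \<in> cs_rvs M" "Y \<in> cs_rvs M" "\<And>w. w \<in> space M \<Longrightarrow> X w \<le> Y w" for X Y
    using that up_levels by (intro quantile_functional_leI level_quantile_mono_rv)
  moreover have "quantile_functional c \<alpha> k (distr M borel (\<lambda>_. 1)) = 1"
  proof -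
    have "distr M borel (\<lambda>_. 1 :: real) = distr M borel (indicator (space M))"
      by (rule distr_cong) auto
    then show ?thesis
      using quantile_functional_indicator[OF assms sets.top] \<alpha>
      by (simp add: prob_space upper_level_def)
  qed
  ultimately show ?thesis
    by (simp add: comonotonic_functional_def law_based_def comonotonic_additive_def)
qed

end

section \<open>The two implications of the equivalence\<close>

lemma cdf_le_of_fosd:
  assumes F: "F \<in> cs_distributions" and G: "G \<in> cs_distributions"
    and fosd: "\<And>f :: real \<Rightarrow> real. mono f \<Longrightarrow> (\<integral>x. f x \<partial>F) \<le> (\<integral>x. f x \<partial>G)"
  shows "cdf G x \<le> cdf F x"
proof -
  \<comment> \<open>The test function is the indicator of an open upper half line, which is
    increasing.\<close>
  have cdf: "(\<integral>y. indicator {x<..} y \<partial>H) = 1 - cdf H x" if "H \<in> cs_distributions" for H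
  proof -
    interpret H: real_distribution H
      using that by (auto simp: cs_distributions_def)
    have "{x<..} = space H - {..x}" by auto
    then show ?thesis
      using H.prob_compl[of "{..x}"] by (simp add: cdf_def)
  qed
  have "mono (indicator {x<..} :: real \<Rightarrow> real)"
    by (auto simp: mono_def indicator_def)
  from fosd[OF this] show ?thesis
    unfolding cdf[OF F] cdf[OF G] by simp
qed

context prob_space begin

lemma quantile_functional_properties:
  assumes na: "nonatomic M" and lb: "law_based M \<rho>"
    and c: "0 \<le> c" "c \<le> 1" and \<alpha>: "0 < \<alpha>" "\<alpha> \<le> 1" and k: "0 < k" "k \<le> 1"
    and \<rho>: "\<And>X. X \<in> cs_rvs M \<Longrightarrow> \<rho> X = quantile_functional c \<alpha> k (distr M borel X)"
  shows "fosd_monotone M \<rho>" "comonotonic_additive M \<rho>" "p_quasi_convex M \<rho>"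
    "p_locally_indifferent M \<rho>" "\<rho> (\<lambda>_. 1) = 1"
proof -
  have k0: "0 \<le> k" using k by simp
  note params = c \<alpha> k0 k(2)
  have law: "on_laws M \<rho> F = quantile_functional c \<alpha> k F" if "F \<in> cs_distributions" for F
    using on_laws_representative[OF na lb that] \<rho> by metis
  show "fosd_monotone M \<rho>"
    unfolding fosd_monotone_def
    using up_levels[OF params] cdf_le_of_fosd
    by (auto simp: law intro!: quantile_functional_leI[OF params] level_quantile_mono)
  show "p_quasi_convex M \<rho>"
    unfolding p_quasi_convex_def
    using quantile_functional_quasi_convex[OF params]
    by (auto simp: law mixture_cs_distributions)
  note com = quantile_functional_comonotonic[OF params prob_space_axioms]
  show "comonotonic_additive M \<rho>"
    using com \<rho> add_cs_rvs by (simp add: comonotonic_functional_def comonotonic_additive_def)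
  show "\<rho> (\<lambda>_. 1) = 1"
    using cf_one[OF com] \<rho>[OF const_cs_rvs] by simp
  have val: "\<rho> (indicator A) = k" if "A \<in> events" "1 - \<alpha> < prob A" "prob A < 1" for A
    using that \<alpha> by (simp add: \<rho> indicator_cs_rvs quantile_functional_indicator[OF params prob_space_axioms] upper_level_def)
  obtain U where U [measurable]: "U \<in> borel_measurable M"
    and Ule: "\<And>t. 0 \<le> t \<Longrightarrow> t \<le> 1 \<Longrightarrow> prob {w \<in> space M. U w \<le> t} = t"
    using nonatomic_uniform[OF na] by metis
  \<comment> \<open>For \<open>t > 1\<close> the probability \<open>1 - \<alpha> / t\<close> lies
    strictly between \<open>1 - \<alpha>\<close> and 1, on the plateau of height \<open>k\<close>.
    Two values of \<open>t\<close> give the two events for local indifference.\<close>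
  let ?A = "\<lambda>t. {w \<in> space M. U w \<le> 1 - \<alpha> / t}"
  have A: "?A t \<in> events" "prob (?A t) = 1 - \<alpha> / t" if "1 < t" for t
  proof -
    have "0 \<le> 1 - \<alpha> / t" "1 - \<alpha> / t \<le> 1"
      using that \<alpha> by (auto simp: field_simps)
    then show "prob (?A t) = 1 - \<alpha> / t"
      by (rule Ule)
  qed simp
  have "\<alpha> / t < \<alpha>" "0 < \<alpha> / t" if "1 < t" for t
    using that \<alpha> by (auto simp: field_simps)
  then have "\<rho> (indicator (?A t)) = k" if "1 < t" for t
    using that A[OF that] by (intro val) auto
  moreover have "\<rho> (\<lambda>_. 0) = 0"
    using cf_zero[OF com] \<rho>[OF const_cs_rvs] by simp
  moreover have "prob (?A 2) \<noteq> prob (?A 3)"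
    using A(2)[of 2] A(2)[of 3] \<alpha> by simp
  ultimately show "p_locally_indifferent M \<rho>"
    unfolding p_locally_indifferent_def using k A(1)[of 2] A(1)[of 3]
    by (intro bexI[of _ "?A 2"] bexI[of _ "?A 3"]) auto
qed

lemma comonotonic_functional_quantile:
  assumes na: "nonatomic M" and \<rho>: "comonotonic_functional M \<rho>" and qc: "p_quasi_convex M \<rho>"
    and li: "p_locally_indifferent M \<rho>"
  obtains c \<alpha> k where "0 \<le> c" "c \<le> 1" "0 < \<alpha>" "\<alpha> \<le> 1" "0 < k" "k \<le> 1"
    "\<And>X. X \<in> cs_rvs M \<Longrightarrow> \<rho> X = quantile_functional c \<alpha> k (distr M borel X)"
proof -
  obtain U where U [measurable]: "U \<in> borel_measurable M"
    and Ule: "\<And>t. 0 \<le> t \<Longrightarrow> t \<le> 1 \<Longrightarrow> prob {w \<in> space M. U w \<le> t} = t"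
    using nonatomic_uniform[OF na] by metis
  define h where "h p = \<rho> (indicator {w \<in> space M. U w \<le> p})" for p
  have \<rho>_h: "\<rho> (indicator A) = h (prob A)" if "A \<in> events" for A
    unfolding h_def using that
    by (intro cf_law[OF \<rho>] indicator_cs_rvs distr_indicator_cong) (auto simp: Ule)
  have h0: "h 0 = 0"
    using \<rho>_h[of "{}"] cf_zero[OF \<rho>] by (simp add: indicator_def[abs_def])
  have "distr M borel (\<lambda>_. 1 :: real) = distr M borel (indicator (space M))"
    by (rule distr_cong) auto
  then have "\<rho> (\<lambda>_. 1) = \<rho> (indicator (space M))"
    by (intro cf_law[OF \<rho>] indicator_cs_rvs const_cs_rvs) auto
  then have h1: "h 1 = 1"
    using \<rho>_h[of "space M"] cf_one[OF \<rho>] by (simp add: prob_space)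
  have mono: "h x \<le> h y" if "0 \<le> x" "x \<le> y" "y \<le> 1" for x y
    unfolding h_def using that by (intro cf_mono[OF \<rho>] indicator_cs_rvs) (auto simp: indicator_def)
  obtain A B where AB: "A \<in> events" "B \<in> events" "prob A \<noteq> prob B" "\<rho> (indicator A) = \<rho> (indicator B)"
      "\<rho> (\<lambda>_. 0) < \<rho> (indicator B)"
    using li by (auto simp: p_locally_indifferent_def)
  then have AB_h: "h (prob A) = h (prob B)" "0 < h (prob B)"
    using \<rho>_h cf_zero[OF \<rho>] by auto
  define p where "p = min (prob A) (prob B)"
  define q where "q = max (prob A) (prob B)"
  have pq: "0 \<le> p" "p < q" "q \<le> 1" "h p = h q" "0 < h q"
    using AB(3) AB_h by (auto simp: p_def q_def min_def max_def)
  have mix: "real m * h (l * a1 + (1 - l) * b1) + real n * h (l * a2 + (1 - l) * b2)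
      \<le> max (real m * h a1 + real n * h a2) (real m * h b1 + real n * h b2)"
    if "0 \<le> a2" "a2 \<le> a1" "a1 \<le> 1" "0 \<le> b2" "b2 \<le> b1" "b1 \<le> 1" "0 \<le> l" "l \<le> 1"
    for a1 a2 b1 b2 l and m n :: nat
    using comonotonic_functional_step[OF \<rho> qc U Ule that] by (simp add: h_def)
  obtain s v where sv: "0 \<le> s" "s < 1" "0 < v" "v \<le> 1" "0 \<le> h s" "h s \<le> v"
    and below: "\<And>x. 0 \<le> x \<Longrightarrow> x < s \<Longrightarrow> h x = 0" and above: "\<And>x. s < x \<Longrightarrow> x < 1 \<Longrightarrow> h x = v"
    using two_step_distortion[OF h0 h1 mono mix pq] by blast
  \<comment> \<open>The parameters are read off the distortion: \<open>k\<close> is the plateau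
    height \<open>v\<close>, \<alpha> is \<open>1 - s\<close>, and \<open>c\<close> is the fraction
    of the jump attained at \<open>s\<close> itself.\<close>
  have c: "0 \<le> h s / v" "h s / v \<le> 1" and \<alpha>: "0 < 1 - s" "1 - s \<le> 1" and v: "0 \<le> v" "v \<le> 1"
    using sv by (auto simp: field_simps)
  note params = c \<alpha> v
  have "\<rho> (indicator A) = quantile_functional (h s / v) (1 - s) v (distr M borel (indicator A))"
    if A: "A \<in> events" for A
  proof -
    define p where "p = prob A"
    have p: "0 \<le> p" "p \<le> 1" by (auto simp: p_def)
    have "h p = v * (h s / v * (if upper_level (1 - s) (1 - p) then 0 else 1) +
        (1 - h s / v) * (if 1 - s \<le> 1 - p then 0 else 1)) + (1 - v) * (if p < 1 then 0 else 1)"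
    proof -
      \<comment> \<open>The point \<open>p = s = 0\<close> is separate: there \<alpha> is 1, so
        \<open>upper_level\<close> is the closed threshold and the value is
        \<open>h 0 = 0\<close>.\<close>
      consider "p < s" | "p = s" "s = 0" | "p = s" "0 < s" | "s < p" "p < 1" | "s < p" "p = 1"
        using p sv by linarith
      then show ?thesis
        using below[of p] above[of p] h0 h1 p sv
        by cases (auto simp: upper_level_def field_simps)
    qed
    then show ?thesis
      unfolding \<rho>_h[OF A] quantile_functional_indicator[OF params prob_space_axioms A] p_def .
  qed
  then have "\<rho> X = quantile_functional (h s / v) (1 - s) v (distr M borel X)" if "X \<in> cs_rvs M" for X
    using that comonotonic_functional_eqI[OF \<rho> quantile_functional_comonotonic[OF params prob_space_axioms]]
    by blast
  then show ?thesis
    using that[of "h s / v" "1 - s" v] params sv by blast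
qed

end

theorem proposition2:
  fixes M :: "'a measure" and \<rho> :: "('a \<Rightarrow> real) \<Rightarrow> real"
  assumes "prob_space M" and "nonatomic M" and "law_based M \<rho>"
  shows "(fosd_monotone M \<rho> \<and> comonotonic_additive M \<rho> \<and> p_quasi_convex M \<rho> \<and>
          p_locally_indifferent M \<rho> \<and> \<rho> (\<lambda>_. 1) = 1) \<longleftrightarrow>
         (\<exists>c\<in>{0..1}. \<exists>\<alpha>\<in>{0<..1}. \<exists>k\<in>{0<..1}. \<forall>X\<in>cs_rvs M.
            \<rho> X = k * quantile_mix c \<alpha> (distr M borel X) + (1 - k) * quantile_zero (distr M borel X))"
  (is "?L \<longleftrightarrow> ?R")
proof
  interpret prob_space M by fact
  assume L: ?L
  then have "comonotonic_functional M \<rho>"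
    using assms(3) fosd_monotone_rv[OF assms(3)] by (simp add: comonotonic_functional_def)
  then obtain c \<alpha> k where "0 \<le> c" "c \<le> 1" "0 < \<alpha>" "\<alpha> \<le> 1" "0 < k" "k \<le> 1"
    "\<And>X. X \<in> cs_rvs M \<Longrightarrow> \<rho> X = quantile_functional c \<alpha> k (distr M borel X)"
    using comonotonic_functional_quantile[OF assms(2)] L by metis
  then show ?R
    unfolding quantile_functional_def
    by (intro bexI[of _ c] bexI[of _ \<alpha>] bexI[of _ k]) auto
next
  interpret prob_space M by fact
  assume ?R
  then obtain c \<alpha> k where "0 \<le> c" "c \<le> 1" "0 < \<alpha>" "\<alpha> \<le> 1" "0 < k" "k \<le> 1"
    "\<And>X. X \<in> cs_rvs M \<Longrightarrow> \<rho> X = quantile_functional c \<alpha> k (distr M borel X)"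
    unfolding quantile_functional_def by auto
  from quantile_functional_properties[OF assms(2,3) this] show ?L
    by blast
qed

end
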